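(* Let $\mathsf{E}_8\subset\mathbb{R}^8$ be the set of the 240 shortest vectors of the $E_8$ lattice, $$\mathsf{E}_8=\{\pm e_i\pm e_j \mid 1\le i<j\le 8\}\cup\left\{\left(\pm\tfrac12,\pm\tfrac12,\ldots,\pm\tfrac12\right)\ \middle|\ \text{an even number of minus signs}\right\}.$$ For each of the 120 antipodal pairs $\pm a$ of points of $\mathsf{E}_8$ choose one representative $a$ and seven linearly independent vectors $b_{a,1},\ldots,b_{a,7}\in\mathbb{R}^8$ orthogonal to $a$, and let $$B_a=\left\{(b_{a,i}\cdot Y)(a\cdot Y-1)(a\cdot Y)(a\cdot Y+1)\ \middle|\ 1\le i\le 7\right\}\subset\mathbb{C}[Y_1,\ldots,Y_8].$$ Let $\mathrm{Nm}=\sum_{i=1}^8Y_i^2-2$, let $\mathcal{G}$ be the set consisting of $\mathrm{Nm}$ together with the $120\cdot 7$ polynomials in the sets $B_a$, and let $I=\langle\mathcal{G}\rangle$ be the ideal of $\mathbb{C}[Y_1,\ldots,Y_8]$ generated by $\mathcal{G}$. Then: (i) $\mathcal{Z}(I)=\mathsf{E}_8$ in $\mathbb{C}^8$; (ii) each zero of $I$ is simple, so $I$ is a radical ideal; (iii) the smallest degree of a non-trivial polynomial in $\mathcal{I}(\mathsf{E}_8)$ is four; (iv) $\mathcal{I}(\mathsf{E}_8)$ is generated by a set of polynomials all having degree four or less.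
   Context: $e_1,\ldots,e_8$ is the standard basis of $\mathbb{R}^8$, and $a\cdot Y=a_1Y_1+\cdots+a_8Y_8$. For a set $X\subseteq\mathbb{C}^m$, $\mathcal{I}(X)$ is the ideal of all polynomials in $\mathbb{C}[Y_1,\ldots,Y_m]$ vanishing at every point of $X$. For a set (or ideal) $S$ of polynomials, $\mathcal{Z}(S)$ is the set of all points of $\mathbb{C}^m$ at which every element of $S$ vanishes. A polynomial is trivial if it is divisible by $\mathrm{Nm}$ (in particular the zero polynomial is trivial), and non-trivial otherwise. Degree means total degree. A zero $p$ of an ideal generated by $F_1,\ldots,F_n\in\mathbb{C}[Y_1,\ldots,Y_m]$ is simple if the Jacobian matrix $\left(\partial F_i/\partial Y_j\big|_p\right)$ has rank $m$ (equivalently, the Zariski tangent space of the ideal at $p$ is zero-dimensional). *)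

theory Defs
  imports "HOL-Analysis.Analysis" "HOL-Library.Poly_Mapping"
begin

(* Polynomials over the complex numbers in variables indexed by 'v: a finitely supported map from
   exponent vectors to coefficients.  Poly_Mapping supplies the ring structure (convolution). *)
type_synonym 'v cpoly = "('v \<Rightarrow>\<^sub>0 nat) \<Rightarrow>\<^sub>0 complex"

definition Const :: "complex \<Rightarrow> 'v cpoly" where
  "Const c = Poly_Mapping.single 0 c"

definition Var :: "'v \<Rightarrow> 'v cpoly" where
  "Var i = Poly_Mapping.single (Poly_Mapping.single i 1) 1"

definition eval_poly :: "'v::finite cpoly \<Rightarrow> complex ^ 'v \<Rightarrow> complex" where
  "eval_poly f p = (\<Sum>m\<in>Poly_Mapping.keys f.
     Poly_Mapping.lookup f m * (\<Prod>i\<in>UNIV. (p $ i) ^ Poly_Mapping.lookup m i))"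

(* The zero polynomial gets degree 0. *)
definition total_degree :: "'v::finite cpoly \<Rightarrow> nat" where
  "total_degree f =
     Max (insert 0 ((\<lambda>m. \<Sum>i\<in>UNIV. Poly_Mapping.lookup m i) ` Poly_Mapping.keys f))"

(* Exponents are subtracted with truncation, but the coefficient is 0 where that happens. *)
definition partial_deriv :: "'v \<Rightarrow> 'v cpoly \<Rightarrow> 'v cpoly" where
  "partial_deriv j f = (\<Sum>m\<in>Poly_Mapping.keys f.
     Poly_Mapping.single (m - Poly_Mapping.single j 1)
       (Poly_Mapping.lookup f m * of_nat (Poly_Mapping.lookup m j)))"

(* The ideal generated by S: the submodule spanned by S in the ring seen as a module over itself. *)
definition ideal_gen :: "'a::comm_ring_1 set \<Rightarrow> 'a set" where
  "ideal_gen S = module.span (*) S"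

definition radical_ideal :: "'a::comm_ring_1 set \<Rightarrow> bool" where
  "radical_ideal J \<longleftrightarrow> ideal_gen J = J \<and> (\<forall>f n. f ^ n \<in> J \<longrightarrow> f \<in> J)"

definition zero_locus :: "'v::finite cpoly set \<Rightarrow> (complex ^ 'v) set" where
  "zero_locus S = {p. \<forall>f\<in>S. eval_poly f p = 0}"

definition vanishing_ideal :: "(complex ^ 'v::finite) set \<Rightarrow> 'v cpoly set" where
  "vanishing_ideal X = {f. \<forall>p\<in>X. eval_poly f p = 0}"

definition jacobian_row :: "'v::finite cpoly \<Rightarrow> complex ^ 'v \<Rightarrow> complex ^ 'v" where
  "jacobian_row f p = (\<chi> j. eval_poly (partial_deriv j f) p)"

(* The dimension of the space spanned by the rows is the library's definition of the rank of a
   matrix, row_rank_def_gen; spelled out here because the rows are indexed by the set S of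
   generators rather than by a finite type. *)
definition jacobian_rank :: "'v::finite cpoly set \<Rightarrow> complex ^ 'v \<Rightarrow> nat" where
  "jacobian_rank S p = vec.dim ((\<lambda>f. jacobian_row f p) ` S)"

definition simple_zero :: "'v::finite cpoly set \<Rightarrow> complex ^ 'v \<Rightarrow> bool" where
  "simple_zero S p \<longleftrightarrow> p \<in> zero_locus (ideal_gen S) \<and> jacobian_rank S p = CARD('v)"

(* The numeral type 8 is linearly ordered by the representatives 0, ..., 7. *)
definition E8 :: "(real ^ 8) set" where
  "E8 = {s *\<^sub>R axis i 1 + t *\<^sub>R axis j 1 | s t i j. s \<in> {1, -1} \<and> t \<in> {1, -1} \<and> i < j}
      \<union> {v. (\<forall>i. v $ i \<in> {1/2, -1/2}) \<and> even (card {i. v $ i = -1/2})}"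

definition complexify :: "real ^ 'v \<Rightarrow> complex ^ 'v" where
  "complexify v = (\<chi> i. complex_of_real (v $ i))"

definition lin_form :: "real ^ 'v::finite \<Rightarrow> 'v cpoly" where
  "lin_form a = (\<Sum>i\<in>UNIV. Const (complex_of_real (a $ i)) * Var i)"

definition Nm :: "8 cpoly" where
  "Nm = (\<Sum>i\<in>UNIV. Var i ^ 2) - Const 2"

definition nontrivial :: "8 cpoly \<Rightarrow> bool" where
  "nontrivial f \<longleftrightarrow> \<not> Nm dvd f"

definition antipodal_representatives :: "(real ^ 8) set \<Rightarrow> bool" where
  "antipodal_representatives R \<longleftrightarrow> R \<subseteq> E8 \<and> (\<forall>v\<in>E8. \<exists>!a. a \<in> R \<and> (a = v \<or> a = - v))"

definition B_set :: "real ^ 8 \<Rightarrow> (nat \<Rightarrow> real ^ 8) \<Rightarrow> 8 cpoly set" where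
  "B_set a c =
     (\<lambda>i. lin_form (c i) * (lin_form a - 1) * lin_form a * (lin_form a + 1)) ` {1..7}"

definition generators :: "(real ^ 8) set \<Rightarrow> (real ^ 8 \<Rightarrow> nat \<Rightarrow> real ^ 8) \<Rightarrow> 8 cpoly set" where
  "generators R b = insert Nm (\<Union>a\<in>R. B_set a (b a))"

end

theory Submission
  imports Defs
begin

text \<open>
  Let \<open>L = a \<cdot> Y\<close> for a root \<open>a\<close>, and let \<open>I\<close> be the ideal in question. Everything about \<open>I\<close> follows from one
  computation: \<open>I\<close> contains the separable polynomial \<open>(L + 2) (L + 1) L (L - 1) (L - 2)\<close>. The vectors
  \<open>b a i\<close> span the hyperplane orthogonal to \<open>a\<close>, so \<open>(c \<cdot> Y) L (L\<^sup>2 - 1)\<close> lies in \<open>I\<close> for every \<open>c\<close>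
  orthogonal to \<open>a\<close>. Since the norm of a root is 2, the projection of \<open>Y\<close> to that hyperplane has squared length
  \<open>|Y|\<^sup>2 - L\<^sup>2 / 2\<close>, which is \<open>2 - L\<^sup>2 / 2\<close> modulo \<open>Nm\<close>; hence \<open>(4 - L\<^sup>2) L (L\<^sup>2 - 1)\<close> lies in \<open>I\<close>
  (\<open>root_polynomial_in_ideal\<close>).
  
  \<^item> At a zero of \<open>I\<close> all forms \<open>a \<cdot> Y\<close> therefore take integer values. So the zero is a real vector of squared
    length 2 in the dual of the root lattice. The lattice is its own dual, and the zero is a root
    (\<open>E8_if_integral\<close>).
  
  \<^item> The polynomial has simple roots, so its gradient at a zero is a nonzero multiple of \<open>a\<close>. The roots span
    the space, and every zero is simple (\<open>jacobian_rank_full\<close>).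
  
  \<^item> Each coordinate is half the sum of two of the forms \<open>L\<close>, so modulo \<open>I\<close> it satisfies a separable
    polynomial as well. Seidenberg's criterion (\<open>seidenberg\<close>) turns this into the equality of \<open>I\<close> with the
    vanishing ideal of its zeros. Radicality is then clear, and the given generators, all of degree at
    most four, generate the vanishing ideal.
  
  It remains to see that a polynomial of degree at most three that vanishes on the roots is a multiple of
  \<open>Nm\<close> (\<open>Nm_dvd_if_degree_le_3\<close>). Modulo \<open>Nm\<close> the constant 1 may be replaced by \<open>|Y|\<^sup>2 / 2\<close>, so the
  polynomial becomes a quadratic form plus a cubic form. As \<open>-x\<close> is a root with \<open>x\<close>, both forms vanish on the
  roots separately. There are enough roots to force them to be zero: the roots \<open>\<plusminus>e\<^sub>i \<plusminus> e\<^sub>j\<close> kill the quadratic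
  form and relate the coefficients of \<open>x\<^sub>i\<^sup>3\<close> and \<open>x\<^sub>i x\<^sub>j\<^sup>2\<close>, a third difference over three orthogonal roots kills
  the coefficients of \<open>x\<^sub>i x\<^sub>j x\<^sub>k\<close>, and the half-integral roots kill what is left.
\<close>

section \<open>Evaluation of polynomials\<close>

lemma sum_monomials: "f = (\<Sum>m\<in>Poly_Mapping.keys f. Poly_Mapping.single m (Poly_Mapping.lookup f m))"
  by (rule poly_mapping_eqI)
    (simp add: lookup_sum lookup_single when_def sum.delta in_keys_iff)

lemma poly_additive_induct [case_names monomial add]:
  fixes f :: "'v cpoly"
  assumes "\<And>m c. P (Poly_Mapping.single m c)"
    and "\<And>f g. P f \<Longrightarrow> P g \<Longrightarrow> P (f + g)"
  shows "P f"
proof -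
  have "P (\<Sum>m\<in>M. Poly_Mapping.single m (Poly_Mapping.lookup f m))" if "finite M" for M
    using that
  proof induction
    case empty
    show ?case using assms(1)[of 0 0] by simp
  qed (simp add: assms)
  then show ?thesis
    by (metis finite_keys sum_monomials)
qed

lemma eval_poly_superset:
  assumes "finite M" "Poly_Mapping.keys f \<subseteq> M"
  shows "eval_poly f p =
    (\<Sum>m\<in>M. Poly_Mapping.lookup f m * (\<Prod>i\<in>UNIV. (p $ i) ^ Poly_Mapping.lookup m i))"
  unfolding eval_poly_def
  by (rule sum.mono_neutral_left) (use assms in \<open>auto simp: in_keys_iff\<close>)

lemma eval_poly_add [simp]: "eval_poly (f + g) p = eval_poly f p + eval_poly g p"
proof -
  let ?M = "Poly_Mapping.keys f \<union> Poly_Mapping.keys g"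
  have "Poly_Mapping.keys (f + g) \<subseteq> ?M"
    by (rule keys_add)
  then show ?thesis
    by (simp add: eval_poly_superset[of ?M] lookup_add sum.distrib distrib_right)
qed

lemma eval_poly_monomial [simp]:
  "eval_poly (Poly_Mapping.single m c) p = c * (\<Prod>i\<in>UNIV. (p $ i) ^ Poly_Mapping.lookup m i)"
  by (subst eval_poly_superset[of "{m}"]) (auto simp: lookup_single)

lemma eval_poly_zero [simp]: "eval_poly 0 p = 0"
  by (simp add: eval_poly_def)

lemma eval_poly_uminus [simp]: "eval_poly (- f) p = - eval_poly f p"
  by (metis add.right_inverse add_eq_0_iff eval_poly_add eval_poly_zero)

lemma eval_poly_diff [simp]: "eval_poly (f - g) p = eval_poly f p - eval_poly g p"
  by (metis diff_conv_add_uminus eval_poly_add eval_poly_uminus)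

lemma eval_poly_sum [simp]: "eval_poly (\<Sum>i\<in>A. f i) p = (\<Sum>i\<in>A. eval_poly (f i) p)"
  by (induction A rule: infinite_finite_induct) auto

lemma eval_poly_mult [simp]: "eval_poly (f * g) p = eval_poly f p * eval_poly g p"
proof (induction f rule: poly_additive_induct)
  case (monomial m c)
  show ?case
    by (induction g rule: poly_additive_induct)
      (simp_all add: mult_single lookup_add power_add prod.distrib ring_distribs)
qed (simp add: ring_distribs)

lemma eval_poly_Const [simp]: "eval_poly (Const c) p = c"
  by (simp add: Const_def)

lemma Const_1 [simp]: "Const 1 = 1"
  by (simp add: Const_def)

lemma Const_0 [simp]: "Const 0 = 0"
  by (simp add: Const_def)

lemma Const_add: "Const (c + d) = Const c + Const d"
  by (simp add: Const_def single_add)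

lemma Const_diff: "Const (c - d) = Const c - Const d"
  by (simp add: Const_def single_diff)

lemma Const_mult: "Const (c * d) = Const c * Const d"
  by (simp add: Const_def mult_single)

lemma Const_mult_inverse: "c \<noteq> 0 \<Longrightarrow> Const (1 / c) * (Const c * f) = f"
  by (simp flip: mult.assoc Const_mult)

lemma eval_poly_1 [simp]: "eval_poly 1 p = 1"
  by (metis Const_1 eval_poly_Const)

lemma eval_poly_power [simp]: "eval_poly (f ^ n) p = eval_poly f p ^ n"
  by (induction n) auto

lemma eval_poly_Var [simp]: "eval_poly (Var i) p = p $ i"
proof -
  have "(\<Prod>k\<in>UNIV. (p $ k) ^ (Poly_Mapping.lookup (Poly_Mapping.single i 1) k)) =
    (\<Prod>k\<in>UNIV. if k = i then p $ k else 1)"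
    by (rule prod.cong) (auto simp: lookup_single)
  then show ?thesis
    by (simp add: Var_def prod.delta)
qed

section \<open>Induction, degree and decomposition of polynomials\<close>

lemma monomial_peel_variable:
  assumes "Poly_Mapping.lookup m i \<noteq> 0"
  shows "Poly_Mapping.single m c = Var i * Poly_Mapping.single (m - Poly_Mapping.single i 1) c"
proof -
  have "Poly_Mapping.single i 1 + (m - Poly_Mapping.single i 1) = m"
    by (rule poly_mapping_eqI) (use assms in \<open>auto simp: lookup_add lookup_minus lookup_single when_def\<close>)
  then show ?thesis
    by (simp add: Var_def mult_single)
qed

lemma degree_peel_variable:
  fixes m :: "'v::finite \<Rightarrow>\<^sub>0 nat"
  assumes "Poly_Mapping.lookup m i \<noteq> 0"
  shows "(\<Sum>k\<in>UNIV. Poly_Mapping.lookup m k) =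
    Suc (\<Sum>k\<in>UNIV. Poly_Mapping.lookup (m - Poly_Mapping.single i 1) k)"
proof -
  have "(\<Sum>k\<in>UNIV. Poly_Mapping.lookup m k) =
     (\<Sum>k\<in>UNIV. Poly_Mapping.lookup (m - Poly_Mapping.single i 1) k + (if k = i then 1 else 0))"
    by (rule sum.cong) (use assms in \<open>auto simp: lookup_minus lookup_single\<close>)
  then show ?thesis
    by (simp add: sum.distrib sum.delta)
qed

lemma cpoly_induct [case_names Const Var add mult]:
  fixes f :: "'v::finite cpoly"
  assumes const: "\<And>c. P (Const c)"
    and var: "\<And>i. P (Var i)"
    and add: "\<And>f g. P f \<Longrightarrow> P g \<Longrightarrow> P (f + g)"
    and mult: "\<And>f g. P f \<Longrightarrow> P g \<Longrightarrow> P (f * g)"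
  shows "P f"
proof (induction f rule: poly_additive_induct)
  case (monomial m c)
  show ?case
  proof (induction "\<Sum>k\<in>UNIV. Poly_Mapping.lookup m k" arbitrary: m)
    case 0
    then have "m = 0"
      by (intro poly_mapping_eqI) auto
    then show ?case
      using const by (simp add: Const_def)
  next
    case (Suc n)
    then obtain i where i: "Poly_Mapping.lookup m i \<noteq> 0"
      by (metis Zero_not_Suc sum.neutral)
    then show ?case
      unfolding monomial_peel_variable[OF i]
      using Suc by (intro mult var) (simp add: degree_peel_variable[OF i])
  qed
qed (rule add)

lemma total_degree_le_iff:
  "total_degree f \<le> n \<longleftrightarrow> (\<forall>m\<in>Poly_Mapping.keys f. (\<Sum>i\<in>UNIV. Poly_Mapping.lookup m i) \<le> n)"
  by (simp add: total_degree_def)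

lemma total_degree_monomial_le:
  "(\<Sum>i\<in>UNIV. Poly_Mapping.lookup m i) \<le> n \<Longrightarrow> total_degree (Poly_Mapping.single m c) \<le> n"
  by (auto simp: total_degree_le_iff split: if_splits)

lemma total_degree_Const: "total_degree (Const c) \<le> n"
  unfolding Const_def by (rule total_degree_monomial_le) simp

lemma total_degree_Var: "total_degree (Var i) \<le> 1"
  unfolding Var_def by (rule total_degree_monomial_le) (simp add: lookup_single when_def)

lemma total_degree_add: "total_degree f \<le> n \<Longrightarrow> total_degree g \<le> n \<Longrightarrow> total_degree (f + g) \<le> n"
  using keys_add[of f g] by (auto simp: total_degree_le_iff)

lemma total_degree_diff: "total_degree f \<le> n \<Longrightarrow> total_degree g \<le> n \<Longrightarrow> total_degree (f - g) \<le> n"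
  using keys_diff[of f g] by (auto simp: total_degree_le_iff)

lemma total_degree_sum:
  "(\<And>i. i \<in> A \<Longrightarrow> total_degree (f i) \<le> n) \<Longrightarrow> total_degree (\<Sum>i\<in>A. f i) \<le> n"
proof (induction A rule: infinite_finite_induct)
  case (insert x F)
  then show ?case
    by (simp add: total_degree_add)
qed (simp_all add: total_degree_le_iff)

lemma total_degree_mult:
  assumes "total_degree f \<le> k" "total_degree g \<le> l" "k + l \<le> n"
  shows "total_degree (f * g) \<le> n"
  unfolding total_degree_le_iff
proof
  fix m assume "m \<in> Poly_Mapping.keys (f * g)"
  then obtain a b where "a \<in> Poly_Mapping.keys f" "b \<in> Poly_Mapping.keys g" "m = a + b"
    using keys_mult by blast
  moreover from this have "(\<Sum>i\<in>UNIV. Poly_Mapping.lookup a i) \<le> k" "(\<Sum>i\<in>UNIV. Poly_Mapping.lookup b i) \<le> l"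
    using assms by (auto simp: total_degree_le_iff)
  ultimately show "(\<Sum>i\<in>UNIV. Poly_Mapping.lookup m i) \<le> n"
    using assms(3) by (simp add: lookup_add sum.distrib)
qed

lemma total_degree_0_Const:
  assumes "total_degree f \<le> 0"
  obtains c where "f = Const c"
proof
  have "m = 0" if "m \<in> Poly_Mapping.keys f" for m
    using assms that total_degree_le_iff[of f 0] by (intro poly_mapping_eqI) auto
  then have "Poly_Mapping.lookup f m = 0" if "m \<noteq> 0" for m
    using that by (auto simp: in_keys_iff)
  then show "f = Const (Poly_Mapping.lookup f 0)"
    unfolding Const_def by (intro poly_mapping_eqI) (simp add: lookup_single when_def)
qed

text \<open>
  Each nonconstant monomial has a variable that can be split off; doing so lowers the degree of the cofactor.
\<close>
lemma degree_decomposition: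
  fixes f :: "'v::finite cpoly"
  assumes "total_degree f \<le> Suc n"
  obtains c g where "f = Const c + (\<Sum>i\<in>UNIV. Var i * g i)" "\<And>i. total_degree (g i) \<le> n"
proof -
  define P :: "'v cpoly \<Rightarrow> bool" where
    "P f \<longleftrightarrow> (\<exists>c g. f = Const c + (\<Sum>i\<in>UNIV. Var i * g i) \<and> (\<forall>i. total_degree (g i) \<le> n))" for f
  have P_const: "P (Const c)" for c
    unfolding P_def by (intro exI[of _ c] exI[of _ "\<lambda>_. 0"]) (simp add: total_degree_le_iff)
  have P_add: "P (f + g)" if f: "P f" and g: "P g" for f g
  proof -
    obtain c u where "f = Const c + (\<Sum>i\<in>UNIV. Var i * u i)" "\<forall>i. total_degree (u i) \<le> n"
      using f unfolding P_def by blast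
    moreover obtain d v where "g = Const d + (\<Sum>i\<in>UNIV. Var i * v i)" "\<forall>i. total_degree (v i) \<le> n"
      using g unfolding P_def by blast
    ultimately show ?thesis
      unfolding P_def
      by (intro exI[of _ "c + d"] exI[of _ "\<lambda>i. u i + v i"])
        (simp add: Const_add distrib_left sum.distrib total_degree_add)
  qed
  have P_mono: "P (Poly_Mapping.single m c)"
    if deg: "(\<Sum>i\<in>UNIV. Poly_Mapping.lookup m i) \<le> Suc n" for m c
  proof (cases "m = 0")
    case True
    then show ?thesis
      using P_const[of c] by (simp add: Const_def)
  next
    case False
    then obtain i where i: "Poly_Mapping.lookup m i \<noteq> 0"
      by (metis poly_mapping_eqI lookup_zero)
    let ?h = "Poly_Mapping.single (m - Poly_Mapping.single i 1) c"
    have "total_degree ?h \<le> n"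
      using deg unfolding degree_peel_variable[OF i] by (intro total_degree_monomial_le) simp
    moreover have "(\<Sum>k\<in>UNIV. Var k * (if k = i then ?h else 0)) = Poly_Mapping.single m c"
      by (simp add: monomial_peel_variable[OF i] if_distrib[of "(*) _"] sum.delta cong: if_cong)
    ultimately show ?thesis
      unfolding P_def
      by (intro exI[of _ 0] exI[of _ "\<lambda>k. if k = i then ?h else 0"])
        (auto simp: total_degree_le_iff[of 0])
  qed
  have "P (\<Sum>m\<in>M. Poly_Mapping.single m (Poly_Mapping.lookup f m))"
    if "finite M" "M \<subseteq> Poly_Mapping.keys f" for M
    using that
  proof induction
    case empty
    show ?case using P_const[of 0] by simp
  next
    case (insert m M)
    then show ?case
      using assms by (auto simp: total_degree_le_iff intro!: P_add P_mono)
  qed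
  then have "P f"
    by (metis finite_keys sum_monomials order_refl)
  then show ?thesis
    using that unfolding P_def by blast
qed

section \<open>Partial derivatives\<close>

lemma partial_deriv_superset:
  assumes "finite M" "Poly_Mapping.keys f \<subseteq> M"
  shows "partial_deriv j f = (\<Sum>m\<in>M. Poly_Mapping.single (m - Poly_Mapping.single j 1)
     (Poly_Mapping.lookup f m * of_nat (Poly_Mapping.lookup m j)))"
  unfolding partial_deriv_def
  by (rule sum.mono_neutral_left) (use assms in \<open>auto simp: in_keys_iff\<close>)

lemma partial_deriv_add: "partial_deriv j (f + g) = partial_deriv j f + partial_deriv j g"
proof -
  let ?M = "Poly_Mapping.keys f \<union> Poly_Mapping.keys g"
  have "Poly_Mapping.keys (f + g) \<subseteq> ?M"
    by (rule keys_add)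
  then show ?thesis
    by (simp add: partial_deriv_superset[of ?M] lookup_add sum.distrib distrib_right single_add)
qed

lemma partial_deriv_monomial:
  "partial_deriv j (Poly_Mapping.single m c) =
     Poly_Mapping.single (m - Poly_Mapping.single j 1) (c * of_nat (Poly_Mapping.lookup m j))"
  by (subst partial_deriv_superset[of "{m}"]) (auto simp: lookup_single)

text \<open>
  The formal partial derivative computes the analytic one along a coordinate line. The product rule for formal
  derivatives is then inherited from analysis, by uniqueness of derivatives.
\<close>
lemma eval_poly_has_partial_derivative:
  "((\<lambda>t. eval_poly f (p + t *s axis j 1)) has_field_derivative eval_poly (partial_deriv j f) p) (at 0)"
proof (induction f rule: poly_additive_induct)
  case (monomial m c)
  define r where "r = (\<Prod>i\<in>UNIV - {j}. (p $ i) ^ Poly_Mapping.lookup m i)"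
  have split: "(\<Prod>i\<in>UNIV. h i) = h j * (\<Prod>i\<in>UNIV - {j}. h i)" for h :: "'a \<Rightarrow> complex"
    by (simp add: prod.remove)
  have "(\<Prod>i\<in>UNIV. ((p + t *s axis j 1) $ i) ^ Poly_Mapping.lookup m i) =
    (p $ j + t) ^ Poly_Mapping.lookup m j * r" for t
    unfolding split r_def by (simp add: axis_def)
  then have val: "eval_poly (Poly_Mapping.single m c) (p + t *s axis j 1) =
      c * ((p $ j + t) ^ Poly_Mapping.lookup m j * r)" for t
    by simp
  have "(\<Prod>i\<in>UNIV - {j}. (p $ i) ^ Poly_Mapping.lookup (m - Poly_Mapping.single j 1) i) = r"
    unfolding r_def by (rule prod.cong) (auto simp: lookup_minus lookup_single)
  then have der: "eval_poly (partial_deriv j (Poly_Mapping.single m c)) p =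
      c * of_nat (Poly_Mapping.lookup m j) * ((p $ j) ^ (Poly_Mapping.lookup m j - 1) * r)"
    unfolding partial_deriv_monomial eval_poly_monomial split
    by (simp add: lookup_minus)
  show ?case
    unfolding val der by (auto intro!: derivative_eq_intros)
next
  case (add f g)
  then show ?case
    by (auto simp: partial_deriv_add intro: DERIV_add)
qed

lemma jacobian_row_eqI:
  assumes "\<And>j. ((\<lambda>t. eval_poly f (p + t *s axis j 1)) has_field_derivative w $ j) (at 0)"
  shows "jacobian_row f p = w"
  using DERIV_unique[OF eval_poly_has_partial_derivative assms]
  by (simp add: jacobian_row_def vec_eq_iff)

lemma jacobian_row_add: "jacobian_row (f + g) p = jacobian_row f p + jacobian_row g p"
  by (simp add: jacobian_row_def vec_eq_iff partial_deriv_add)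

lemma jacobian_row_mult:
  "jacobian_row (f * g) p = eval_poly g p *s jacobian_row f p + eval_poly f p *s jacobian_row g p"
proof (rule jacobian_row_eqI)
  fix j
  show "((\<lambda>t. eval_poly (f * g) (p + t *s axis j 1)) has_field_derivative
      (eval_poly g p *s jacobian_row f p + eval_poly f p *s jacobian_row g p) $ j) (at 0)"
    using DERIV_mult[OF eval_poly_has_partial_derivative[of f p j] eval_poly_has_partial_derivative[of g p j]]
    by (simp add: jacobian_row_def algebra_simps)
qed

section \<open>Ideals and Seidenberg's criterion\<close>

lemma module_mult: "module ((*) :: 'a::comm_ring_1 \<Rightarrow> 'a \<Rightarrow> 'a)"
  by standard (simp_all add: algebra_simps)

lemma ideal_gen_base: "f \<in> S \<Longrightarrow> f \<in> ideal_gen S"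
  by (simp add: ideal_gen_def module.span_base[OF module_mult])

lemma ideal_gen_zero: "0 \<in> ideal_gen S"
  by (simp add: ideal_gen_def module.span_zero[OF module_mult])

lemma ideal_gen_add: "f \<in> ideal_gen S \<Longrightarrow> g \<in> ideal_gen S \<Longrightarrow> f + g \<in> ideal_gen S"
  by (simp add: ideal_gen_def module.span_add[OF module_mult])

lemma ideal_gen_diff: "f \<in> ideal_gen S \<Longrightarrow> g \<in> ideal_gen S \<Longrightarrow> f - g \<in> ideal_gen S"
  by (simp add: ideal_gen_def module.span_diff[OF module_mult])

lemma ideal_gen_mult: "f \<in> ideal_gen S \<Longrightarrow> h * f \<in> ideal_gen S"
  by (simp add: ideal_gen_def module.span_scale[OF module_mult])

lemma ideal_gen_sum: "(\<And>i. i \<in> A \<Longrightarrow> f i \<in> ideal_gen S) \<Longrightarrow> (\<Sum>i\<in>A. f i) \<in> ideal_gen S"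
  unfolding ideal_gen_def by (rule module.span_sum[OF module_mult])

lemma ideal_gen_mono: "S \<subseteq> T \<Longrightarrow> ideal_gen S \<subseteq> ideal_gen T"
  by (simp add: ideal_gen_def module.span_mono[OF module_mult])

lemma ideal_gen_idem: "ideal_gen (ideal_gen S) = ideal_gen S"
  by (simp add: ideal_gen_def module.span_span[OF module_mult])

lemma ideal_gen_induct [consumes 1, case_names zero step]:
  assumes "f \<in> ideal_gen S" "P 0" "\<And>h g f. g \<in> S \<Longrightarrow> P f \<Longrightarrow> P (h * g + f)"
  shows "P f"
  using assms unfolding ideal_gen_def by (rule module.span_induct_alt[OF module_mult]) auto

lemma ideal_gen_insert_iff: "f \<in> ideal_gen (insert g S) \<longleftrightarrow> (\<exists>h. f - h * g \<in> ideal_gen S)"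
  unfolding ideal_gen_def by (fact module.span_breakdown_eq[OF module_mult])

lemma ideal_gen_Const_multD:
  assumes "Const c * f \<in> ideal_gen S" "c \<noteq> 0"
  shows "f \<in> ideal_gen S"
  using ideal_gen_mult[OF assms(1), of "Const (1 / c)"]
  unfolding Const_mult_inverse[OF assms(2)] .

lemma eval_poly_ideal_gen:
  assumes "f \<in> ideal_gen S" "p \<in> zero_locus S"
  shows "eval_poly f p = 0"
  using assms by (induction rule: ideal_gen_induct) (auto simp: zero_locus_def)

lemma zero_locus_ideal_gen: "zero_locus (ideal_gen S) = zero_locus S"
  using eval_poly_ideal_gen by (auto simp: zero_locus_def ideal_gen_base)

text \<open>
  Polynomial division of \<open>\<Prod>(X - v)\<close> by \<open>X - w\<close>, carried out after substituting \<open>L\<close> for \<open>X\<close>. For \<open>w\<close> outside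
  \<open>V\<close> the remainder is a nonzero constant, which makes the two factors comaximal.
\<close>
lemma prod_shift_remainder:
  assumes "finite V"
  shows "\<exists>u. (\<Prod>v\<in>V. L - Const v) = u * (L - Const w) + Const (\<Prod>v\<in>V. w - v)"
  using assms
proof induction
  case empty
  show ?case by (rule exI[of _ 0]) simp
next
  case (insert v V)
  then obtain u where u: "(\<Prod>v\<in>V. L - Const v) = u * (L - Const w) + Const (\<Prod>v\<in>V. w - v)"
    by blast
  have "(\<Prod>v\<in>insert v V. L - Const v) =
     ((L - Const w) + Const (w - v)) * (u * (L - Const w) + Const (\<Prod>v\<in>V. w - v))"
    using insert.hyps by (simp add: u Const_diff)
  also have "\<dots> = (u * (L - Const v) + Const (\<Prod>v\<in>V. w - v)) * (L - Const w)
     + Const (\<Prod>v\<in>insert v V. w - v)"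
    using insert.hyps by (simp add: Const_diff Const_mult algebra_simps)
  finally show ?case by blast
qed

text \<open>
  By the Chinese remainder theorem the ideals \<open>\<langle>S, L - v\<rangle>\<close>, which are pairwise comaximal, intersect in the ideal
  \<open>\<langle>S, \<Prod>(L - v)\<rangle>\<close>. The induction adds one factor at a time and uses the nonzero remainder \<open>d\<close> of the division.
\<close>
lemma ideal_split_product:
  assumes "finite V" "\<And>v. v \<in> V \<Longrightarrow> f \<in> ideal_gen (insert (L - Const v) S)"
  shows "f \<in> ideal_gen (insert (\<Prod>v\<in>V. L - Const v) S)"
  using assms
proof (induction V)
  case empty
  show ?case
    by (auto simp: ideal_gen_insert_iff ideal_gen_zero intro!: exI[of _ f])
next
  case (insert w V)
  let ?P = "\<Prod>v\<in>V. L - Const v"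
  define d where "d = (\<Prod>v\<in>V. w - v)"
  have d: "d \<noteq> 0"
    using insert.hyps by (auto simp: d_def)
  obtain u where u: "?P = u * (L - Const w) + Const d"
    using prod_shift_remainder[OF insert.hyps(1)] unfolding d_def by blast
  obtain r where r: "f - r * ?P \<in> ideal_gen S"
    using insert.IH insert.prems by (auto simp: ideal_gen_insert_iff)
  obtain s where s: "f - s * (L - Const w) \<in> ideal_gen S"
    using insert.prems[of w] by (auto simp: ideal_gen_insert_iff)
  \<comment> \<open>Modulo \<open>S\<close> both \<open>r ?P\<close> and \<open>s (L - w)\<close> represent \<open>f\<close>; the constant \<open>d = ?P - u (L - w)\<close> combines them.\<close>
  have "Const d * f - (s - r * u) * ((L - Const w) * ?P) =
     ?P * (f - s * (L - Const w)) - (u * (L - Const w)) * (f - r * ?P)"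
    unfolding u by (simp add: algebra_simps)
  also have "\<dots> \<in> ideal_gen S"
    by (intro ideal_gen_diff ideal_gen_mult r s)
  finally have "Const d * f \<in> ideal_gen (insert ((L - Const w) * ?P) S)"
    by (auto simp: ideal_gen_insert_iff)
  then have "f \<in> ideal_gen (insert ((L - Const w) * ?P) S)"
    using d by (rule ideal_gen_Const_multD)
  then show ?case
    using insert.hyps by simp
qed

lemma ideal_split:
  assumes "finite V" "(\<Prod>v\<in>V. L - Const v) \<in> ideal_gen S"
    and "\<And>v. v \<in> V \<Longrightarrow> f \<in> ideal_gen (insert (L - Const v) S)"
  shows "f \<in> ideal_gen S"
proof -
  have "ideal_gen (insert (\<Prod>v\<in>V. L - Const v) S) \<subseteq> ideal_gen (ideal_gen S)"
    using assms(2) by (intro order_trans[OF ideal_gen_mono order_refl]) (auto intro: ideal_gen_base)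
  then show ?thesis
    using ideal_split_product[OF assms(1,3)] by (auto simp: ideal_gen_idem)
qed

text \<open>
  Splitting along several elements in succession. The function \<open>q\<close> prescribes one value for each of them,
  so membership in \<open>\<langle>S\<rangle>\<close> can be tested after all the \<open>L i\<close> have become constants.
\<close>
lemma ideal_split_family:
  assumes "finite A"
    and "\<And>i. i \<in> A \<Longrightarrow> \<exists>V. finite V \<and> (\<Prod>v\<in>V. L i - Const v) \<in> ideal_gen S"
    and "\<And>q. f \<in> ideal_gen ((\<lambda>i. L i - Const (q i)) ` A \<union> S)"
  shows "f \<in> ideal_gen S"
  using assms
proof (induction A arbitrary: S)
  case empty
  then show ?case by simp
next
  case (insert k A)
  obtain V where V: "finite V" "(\<Prod>v\<in>V. L k - Const v) \<in> ideal_gen S"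
    using insert.prems(1) by blast
  show ?case
  proof (rule ideal_split[OF V])
    fix v
    let ?S = "insert (L k - Const v) S"
    show "f \<in> ideal_gen ?S"
    proof (rule insert.IH)
      show "\<exists>V. finite V \<and> (\<Prod>v\<in>V. L i - Const v) \<in> ideal_gen ?S" if "i \<in> A" for i
        using insert.prems(1)[of i] that ideal_gen_mono[of S ?S] by blast
    next
      fix q
      have "(\<lambda>i. L i - Const ((q(k := v)) i)) ` insert k A \<union> S =
          (\<lambda>i. L i - Const (q i)) ` A \<union> ?S"
        using insert.hyps(2) by auto
      then show "f \<in> ideal_gen ((\<lambda>i. L i - Const (q i)) ` A \<union> ?S)"
        using insert.prems(2)[of "q(k := v)"] by simp
    qed
  qed
qed

text \<open>
  An ideal that contains every \<open>Y\<^sub>i - p\<^sub>i\<close> identifies each polynomial with its value at \<open>p\<close>.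
\<close>
lemma poly_cong_value:
  assumes "\<And>i. Var i - Const (p $ i) \<in> ideal_gen S"
  shows "f - Const (eval_poly f p) \<in> ideal_gen S"
proof (induction f rule: cpoly_induct)
  case (Const c)
  then show ?case by (simp add: ideal_gen_zero)
next
  case (Var i)
  then show ?case by (simp add: assms)
next
  case (add f g)
  then show ?case
    using ideal_gen_add[OF add] by (simp add: Const_add algebra_simps)
next
  case (mult f g)
  have "g * (f - Const (eval_poly f p)) + Const (eval_poly f p) * (g - Const (eval_poly g p)) \<in> ideal_gen S"
    by (intro ideal_gen_add ideal_gen_mult mult)
  then show ?case
    by (simp add: Const_mult algebra_simps)
qed

text \<open>
  Seidenberg's criterion over the complex numbers, with split polynomials. Fixing the values of all
  variables leads to the point \<open>p\<close> with these coordinates. If \<open>p\<close> is a common zero of \<open>S\<close>, then \<open>f\<close> is congruent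
  to \<open>f(p) = 0\<close>; otherwise some element of \<open>S\<close> is congruent to a nonzero constant and the ideal is the whole ring.
\<close>
theorem seidenberg:
  fixes S :: "'v::finite cpoly set"
  assumes "\<And>i. \<exists>V. finite V \<and> (\<Prod>v\<in>V. Var i - Const v) \<in> ideal_gen S"
  shows "vanishing_ideal (zero_locus S) = ideal_gen S"
proof
  show "ideal_gen S \<subseteq> vanishing_ideal (zero_locus S)"
    by (auto simp: vanishing_ideal_def eval_poly_ideal_gen)
next
  show "vanishing_ideal (zero_locus S) \<subseteq> ideal_gen S"
  proof
    fix f assume f: "f \<in> vanishing_ideal (zero_locus S)"
    show "f \<in> ideal_gen S"
    proof (rule ideal_split_family[of UNIV Var])
      fix q :: "'v \<Rightarrow> complex"
      let ?T = "(\<lambda>i. Var i - Const (q i)) ` UNIV \<union> S"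
      let ?p = "(\<chi> i. q i) :: complex ^ 'v"
      have cong: "h - Const (eval_poly h ?p) \<in> ideal_gen ?T" for h
        by (rule poly_cong_value) (auto intro!: ideal_gen_base)
      show "f \<in> ideal_gen ?T"
      proof (cases "?p \<in> zero_locus S")
        case True
        then show ?thesis
          using f cong[of f] by (simp add: vanishing_ideal_def)
      next
        case False
        then obtain g where g: "g \<in> S" "eval_poly g ?p \<noteq> 0"
          by (auto simp: zero_locus_def)
        have "g - (g - Const (eval_poly g ?p)) \<in> ideal_gen ?T"
          using g(1) by (intro ideal_gen_diff[OF _ cong]) (simp add: ideal_gen_base)
        then have "Const (eval_poly g ?p) * 1 \<in> ideal_gen ?T"
          by simp
        then have "1 \<in> ideal_gen ?T"
          using g(2) by (rule ideal_gen_Const_multD)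
        then show ?thesis
          using ideal_gen_mult[of 1 ?T f] by simp
      qed
    qed (use assms in auto)
  qed
qed

lemma radical_ideal_vanishing_ideal: "radical_ideal (vanishing_ideal X)"
proof -
  have "f \<in> vanishing_ideal X" if "f \<in> ideal_gen (vanishing_ideal X)" for f
    using that by (induction rule: ideal_gen_induct) (auto simp: vanishing_ideal_def)
  then show ?thesis
    unfolding radical_ideal_def by (auto intro: ideal_gen_base simp: vanishing_ideal_def)
qed

text \<open>
  At a zero \<open>p\<close> of \<open>g\<close> the product rule reads \<open>d(h g) = h(p) d g\<close>. This lets the rank of the Jacobian matrix be bounded below with any elements of the ideal.
\<close>
lemma jacobian_row_ideal_gen:
  assumes "f \<in> ideal_gen S" "p \<in> zero_locus S"
  shows "jacobian_row f p \<in> vec.span ((\<lambda>g. jacobian_row g p) ` S)"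
  using assms(1)
proof (induction rule: ideal_gen_induct)
  case zero
  have "jacobian_row 0 p = 0"
    using jacobian_row_add[of 0 0 p] by simp
  then show ?case by (simp add: vec.span_zero)
next
  case (step h g f)
  have "jacobian_row (h * g + f) p = eval_poly h p *s jacobian_row g p + jacobian_row f p"
    using assms(2) step(1) by (simp add: jacobian_row_add jacobian_row_mult zero_locus_def)
  moreover have "jacobian_row g p \<in> (\<lambda>g. jacobian_row g p) ` S"
    using step(1) by (rule imageI)
  ultimately show ?case
    using step(2) by (simp add: vec.span_add vec.span_scale vec.span_base)
qed

section \<open>The root system\<close>

lemma ex_other_index: "\<exists>k::8. k \<notin> set ks" if "length ks < 8"
proof (rule ccontr)
  assume "\<not> ?thesis"
  then have "set ks = (UNIV :: 8 set)"
    by blast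
  then have "8 = card (set ks)"
    by simp
  with that show False
    using card_length[of ks] by simp
qed

lemma other_index: "\<exists>k::8. i \<noteq> k"
proof -
  obtain k where "k \<notin> set [i]"
    using ex_other_index[of "[i]"] by auto
  then show ?thesis by auto
qed

lemma pair_root:
  assumes "i \<noteq> j" "s \<in> {1, -1}" "t \<in> {1, -1}"
  shows "s *\<^sub>R axis i 1 + t *\<^sub>R axis j 1 \<in> E8"
proof (cases "i < j")
  case True
  then show ?thesis
    using assms unfolding E8_def by blast
next
  case False
  then have "j < i"
    using assms(1) by simp
  then have "t *\<^sub>R axis j 1 + s *\<^sub>R axis i 1 \<in> E8"
    using assms(2,3) unfolding E8_def by blast
  then show ?thesis
    by (simp add: add.commute)
qed

lemma root_add: "i \<noteq> j \<Longrightarrow> axis i 1 + axis j 1 \<in> E8"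
  using pair_root[of i j 1 1] by simp

lemma root_diff: "i \<noteq> j \<Longrightarrow> axis i 1 - axis j 1 \<in> E8"
  using pair_root[of i j 1 "-1"] by simp

lemma E8_cases [consumes 1, case_names pair half]:
  assumes "v \<in> E8"
  obtains s t i j where "i \<noteq> j" "s \<in> {1, -1}" "t \<in> {1, -1}" "v = s *\<^sub>R axis i 1 + t *\<^sub>R axis j 1"
  | "\<forall>i. v $ i \<in> {1/2, -1/2}" "even (card {i. v $ i = -1/2})"
  using assms that unfolding E8_def by (elim UnE CollectE exE conjE) (metis less_irrefl, simp)

lemma half_sign:
  fixes x :: real
  assumes "x \<in> {1/2, -1/2}"
  obtains e where "e \<in> {1, -1}" "x = e / 2"
  using assms by (elim insertE emptyE) (simp_all add: that[of 1] that[of "-1"])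

lemma inner_pair: "(s *\<^sub>R axis i 1 + t *\<^sub>R axis j 1) \<bullet> v = s * v $ i + t * v $ j"
  for v :: "real ^ 'n"
  by (simp add: inner_add_left inner_axis')

text \<open>
  Each coordinate contributes \<open>1/4\<close> if the signs agree and \<open>-1/4\<close> if they differ.
\<close>
lemma half_inner:
  fixes v w :: "real ^ 8"
  assumes "\<forall>i. v $ i \<in> {1/2, -1/2}" "\<forall>i. w $ i \<in> {1/2, -1/2}"
  shows "v \<bullet> w = 2 - real (card {i. v $ i \<noteq> w $ i}) / 2"
proof -
  have "v \<bullet> w = (\<Sum>i\<in>UNIV. 1/4 - (if v $ i \<noteq> w $ i then 1 else 0) / 2)"
    unfolding inner_vec_def
  proof (rule sum.cong)
    fix i
    obtain e f where e: "e \<in> {1, -1}" "v $ i = e / 2" and f: "f \<in> {1, -1}" "w $ i = f / 2"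
      using assms half_sign by metis
    show "v $ i \<bullet> w $ i = 1/4 - (if v $ i \<noteq> w $ i then 1 else 0) / 2"
      unfolding e(2) f(2) using e(1) f(1) by auto
  qed simp
  also have "\<dots> = 2 - (\<Sum>i\<in>UNIV. if v $ i \<noteq> w $ i then 1 else 0) / 2"
    by (simp only: sum_subtractf sum_divide_distrib[symmetric]) simp
  also have "(\<Sum>i\<in>UNIV. if v $ i \<noteq> w $ i then 1 else 0 :: real) = real (card {i. v $ i \<noteq> w $ i})"
    by (simp add: sum.If_cases)
  finally show ?thesis .
qed

text \<open>
  The critical case is that of two half-integral roots: their sign patterns differ on the symmetric difference of
  two sets of even cardinality, which is again even.
\<close>
lemma E8_inner_Ints:
  assumes "v \<in> E8" "w \<in> E8"
  shows "v \<bullet> w \<in> \<int>"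
proof -
  have pair_Ints: "(s *\<^sub>R axis i 1 + t *\<^sub>R axis j 1) \<bullet> u \<in> \<int>"
    if st: "s \<in> {1, -1}" "t \<in> {1, -1}" and u: "u \<in> E8" for s t i j u
    using u
  proof (cases rule: E8_cases)
    case (pair s' t' i' j')
    then have "u $ k \<in> \<int>" for k
      by (auto simp: axis_def)
    then show ?thesis
      using st by (auto simp: inner_pair)
  next
    case half
    obtain e f where e: "e \<in> {1, -1}" "u $ i = e / 2" and f: "f \<in> {1, -1}" "u $ j = f / 2"
      using half(1) half_sign by metis
    show ?thesis
      unfolding inner_pair e(2) f(2) using st e(1) f(1) by auto
  qed
  show ?thesis
    using assms(1)
  proof (cases rule: E8_cases)
    case (pair s t i j)
    show ?thesis
      unfolding pair(4) using pair(2,3) assms(2) by (rule pair_Ints)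
  next
    case v: half
    show ?thesis
      using assms(2)
    proof (cases rule: E8_cases)
      case (pair s t i j)
      show ?thesis
        unfolding pair(4) inner_commute[of v] using pair(2,3) assms(1) by (rule pair_Ints)
    next
      case w: half
      let ?A = "{i. v $ i = -1/2}" and ?B = "{i. w $ i = -1/2}"
      have "v $ i \<noteq> w $ i \<longleftrightarrow> (v $ i = -1/2) \<noteq> (w $ i = -1/2)" for i
        using v(1)[rule_format, of i] w(1)[rule_format, of i] by auto
      then have "{i. v $ i \<noteq> w $ i} = (?A - ?B) \<union> (?B - ?A)"
        by auto
      moreover have "card ((?A - ?B) \<union> (?B - ?A)) = card (?A - ?B) + card (?B - ?A)"
        by (rule card_Un_disjoint) auto
      ultimately have "card {i. v $ i \<noteq> w $ i} = card (?A - ?B) + card (?B - ?A)"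
        by presburger
      moreover have "card ?A = card (?A \<inter> ?B) + card (?A - ?B)" "card ?B = card (?A \<inter> ?B) + card (?B - ?A)"
        by (metis card_Int_Diff finite_code) (metis Int_commute card_Int_Diff finite_code)
      ultimately have "even (card {i. v $ i \<noteq> w $ i})"
        using v(2) w(2) by presburger
      then show ?thesis
        unfolding half_inner[OF v(1) w(1)] by (auto elim!: evenE)
    qed
  qed
qed

lemma E8_norm:
  assumes "v \<in> E8"
  shows "v \<bullet> v = 2"
  using assms
proof (cases rule: E8_cases)
  case (pair s t i j)
  then have "v $ i = s" "v $ j = t"
    by (auto simp: axis_def)
  moreover have "v \<bullet> v = s * v $ i + t * v $ j"
    using inner_pair[of s i t j v] pair(4) by simp
  ultimately show ?thesis
    using pair(2,3) by auto
next
  case half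
  then show ?thesis
    using half_inner[OF half(1) half(1)] by simp
qed

text \<open>
  The \<open>E\<^sub>8\<close> lattice is self-dual. Integrality against \<open>\<plusminus>e\<^sub>i \<plusminus> e\<^sub>j\<close> forces the coordinates to be all integral or all
  half-odd, and length \<open>\<surd>2\<close> leaves two entries \<open>\<plusminus>1\<close> in the first case and all entries \<open>\<plusminus>1/2\<close> in the second.
  In the second case integrality against \<open>(1/2, \<dots>, 1/2)\<close> makes the number of minus signs even.
\<close>
lemma E8_if_integral:
  assumes int: "\<And>a. a \<in> E8 \<Longrightarrow> a \<bullet> v \<in> \<int>" and norm: "v \<bullet> v = 2"
  shows "v \<in> E8"
proof -
  have add: "v $ i + v $ j \<in> \<int>" and diff: "v $ i - v $ j \<in> \<int>" if "i \<noteq> j" for i j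
    using int[OF root_add[OF that]] int[OF root_diff[OF that]]
    by (simp_all add: inner_add_left inner_diff_left inner_axis')
  have norm': "(\<Sum>i\<in>UNIV. (v $ i)\<^sup>2) = 2"
    using norm by (simp add: inner_vec_def power2_eq_square)
  show ?thesis
  proof (cases "\<forall>i. v $ i \<in> \<int>")
    case True
    then have "\<forall>i. \<exists>n. v $ i = of_int n"
      by (auto elim: Ints_cases)
    then obtain n where n: "\<And>i. v $ i = of_int (n i)"
      by metis
    have sum_n: "(\<Sum>i\<in>UNIV. (n i)\<^sup>2) = 2"
      using norm' unfolding n by (metis (mono_tags, lifting) of_int_eq_numeral_iff of_int_power of_int_sum sum.cong)
    have n_cases: "n i \<in> {-1, 0, 1}" for i
    proof -
      have "(n i)\<^sup>2 \<le> 2"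
        unfolding sum_n[symmetric] by (rule member_le_sum) auto
      moreover have "2 * 2 \<le> \<bar>n i\<bar> * \<bar>n i\<bar>" if "2 \<le> \<bar>n i\<bar>"
        using that by (intro mult_mono) auto
      ultimately have "\<not> 2 \<le> \<bar>n i\<bar>"
        by (auto simp: power2_eq_square)
      then show ?thesis
        by auto
    qed
    have "(\<Sum>i\<in>UNIV. (n i)\<^sup>2) = (\<Sum>i\<in>UNIV. if n i \<noteq> 0 then 1 else 0)"
    proof (rule sum.cong)
      fix i
      show "(n i)\<^sup>2 = (if n i \<noteq> 0 then 1 else 0)"
        using n_cases[of i] by auto
    qed simp
    then have "card {i. n i \<noteq> 0} = 2"
      using sum_n by (simp add: sum.If_cases)
    then obtain i j where ij: "{i. n i \<noteq> 0} = {i, j}" "i \<noteq> j"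
      by (auto simp: card_2_iff)
    have "v = v $ i *\<^sub>R axis i 1 + v $ j *\<^sub>R axis j 1"
      unfolding vec_eq_iff
    proof
      fix k
      show "v $ k = (v $ i *\<^sub>R axis i 1 + v $ j *\<^sub>R axis j 1) $ k"
        using ij by (cases "n k = 0") (auto simp: axis_def n)
    qed
    moreover have "v $ i \<in> {1, -1}" "v $ j \<in> {1, -1}"
      using n_cases[of i] n_cases[of j] ij by (auto simp: n)
    ultimately show ?thesis
      using pair_root[OF ij(2)] by metis
  next
    case False
    then obtain i where i: "v $ i \<notin> \<int>" by blast
    have nonint: "v $ j \<notin> \<int>" for j
      using i diff[of i j] Ints_add[of "v $ i - v $ j" "v $ j"] by (cases "i = j") auto
    \<comment> \<open>A number in \<open>\<int>/2\<close> outside \<open>\<int>\<close> has square at least \<open>1/4\<close>, and eight of these already sum to 2.\<close>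
    have quarter: "(v $ j)\<^sup>2 \<ge> 1/4" for j
    proof -
      obtain k where "k \<noteq> j"
        using ex_other_index[of "[j]"] by auto
      then have "2 * v $ j \<in> \<int>"
        using Ints_add[OF add[of j k] diff[of j k]] by auto
      then obtain n where n: "2 * v $ j = of_int n"
        by (auto elim: Ints_cases)
      then have "n \<noteq> 0"
        using nonint[of j] by auto
      then have "1 * 1 \<le> \<bar>n\<bar> * \<bar>n\<bar>"
        by (intro mult_mono) auto
      then have "1 \<le> n * n"
        by simp
      then have "1 \<le> (2 * v $ j) * (2 * v $ j)"
        unfolding n by (metis of_int_1_le_iff of_int_mult)
      then show ?thesis
        by (simp add: power2_eq_square)
    qed
    have "(\<Sum>j\<in>UNIV. (v $ j)\<^sup>2 - 1/4) = 0"
      using norm' by (simp add: sum_subtractf)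
    then have "(v $ j)\<^sup>2 - 1/4 = 0" for j
      using quarter by (subst (asm) sum_nonneg_eq_0_iff) auto
    then have "(v $ j - 1/2) * (v $ j + 1/2) = 0" for j
      by (simp add: algebra_simps power2_eq_square)
    then have half: "\<forall>j. v $ j \<in> {1/2, -1/2}"
      unfolding mult_eq_0_iff eq_diff_eq[symmetric] by (simp add: eq_neg_iff_add_eq_0)
    define half_ones :: "real ^ 8" where "half_ones = (\<chi> i. 1/2)"
    have half_ones_half: "\<forall>j. half_ones $ j \<in> {1/2, -1/2}"
      by (simp add: half_ones_def)
    have "half_ones \<in> E8"
      by (simp add: E8_def half_ones_def)
    then obtain n where "half_ones \<bullet> v = of_int n"
      using int by (auto elim: Ints_cases)
    moreover have "{i. half_ones $ i \<noteq> v $ i} = {i. v $ i = -1/2}"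
    proof -
      have "half_ones $ i \<noteq> v $ i \<longleftrightarrow> v $ i = -1/2" for i
        using half[rule_format, of i] by (auto simp: half_ones_def)
      then show ?thesis by simp
    qed
    ultimately have "2 - real (card {i. v $ i = -1/2}) / 2 = of_int n"
      using half_inner[OF half_ones_half half] by simp
    then have "real_of_int (int (card {i. v $ i = -1/2})) = real_of_int (2 * (2 - n))"
      by simp
    then have "int (card {i. v $ i = -1/2}) = 2 * (2 - n)"
      by (simp only: of_int_eq_iff)
    then have "even (card {i. v $ i = -1/2})"
      by (metis dvd_triv_left even_of_nat_iff)
    then show ?thesis
      using half by (simp add: E8_def)
  qed
qed

lemma E8_uminus: "v \<in> E8 \<Longrightarrow> - v \<in> E8"
  by (rule E8_if_integral) (simp_all add: E8_norm E8_inner_Ints)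

lemma E8_diff:
  assumes "v \<in> E8" "a \<in> E8" "a \<bullet> v = 1"
  shows "v - a \<in> E8"
  by (rule E8_if_integral)
    (use assms in \<open>simp_all add: inner_diff_left inner_diff_right E8_norm E8_inner_Ints inner_commute\<close>)

text \<open>
  The inner product of two roots is an integer \<open>n\<close>, and \<open>|v \<minusplus> a|\<^sup>2 = 4 \<minusplus> 2 n\<close> bounds it by 2 and settles equality.
\<close>
lemma E8_inner_cases:
  assumes "a \<in> E8" "v \<in> E8"
  shows "a \<bullet> v \<in> {-1, 0, 1} \<or> v = a \<or> v = - a"
proof -
  obtain n where n: "a \<bullet> v = of_int n"
    using E8_inner_Ints[OF assms] by (auto elim: Ints_cases)
  have m: "(v - a) \<bullet> (v - a) = 4 - 2 * of_int n" and p: "(v + a) \<bullet> (v + a) = 4 + 2 * of_int n"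
    using assms n by (simp_all add: inner_diff_left inner_diff_right inner_add_left inner_add_right E8_norm inner_commute)
  have "n \<le> 2" "- 2 \<le> n"
    using inner_ge_zero[of "v - a"] inner_ge_zero[of "v + a"] unfolding m p by linarith+
  then consider "n \<in> {-1, 0, 1}" | "n = 2" | "n = -2"
    by force
  then show ?thesis
  proof cases
    case 1
    then show ?thesis by (auto simp: n)
  next
    case 2
    then show ?thesis using m by simp
  next
    case 3
    then have "(v + a) \<bullet> (v + a) = 0" using p by simp
    then show ?thesis by (simp add: eq_neg_iff_add_eq_0)
  qed
qed

section \<open>The ideal generated by the root polynomials\<close>

lemma Const_uminus: "Const (- c) = - Const c"
  by (simp add: Const_def single_uminus)

lemma Const_numeral [simp]: "Const (numeral n) = numeral n"
  by (simp add: Const_def)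

lemma eval_poly_numeral [simp]: "eval_poly (numeral n) p = numeral n"
  by (metis Const_numeral eval_poly_Const)

lemma lin_form_add: "lin_form (c + d) = lin_form c + lin_form d"
  by (simp add: lin_form_def Const_add sum.distrib distrib_right)

lemma lin_form_scaleR: "lin_form (r *\<^sub>R c) = Const (of_real r) * lin_form c"
  by (simp add: lin_form_def Const_mult sum_distrib_left mult.assoc)

lemma lin_form_zero [simp]: "lin_form 0 = 0"
  by (simp add: lin_form_def)

lemma lin_form_uminus: "lin_form (- c) = - lin_form c"
  by (simp add: lin_form_def Const_uminus sum_negf)

lemma lin_form_diff: "lin_form (c - d) = lin_form c - lin_form d"
  by (simp add: lin_form_def Const_diff sum_subtractf left_diff_distrib)

lemma lin_form_axis [simp]: "lin_form (axis i 1) = Var i"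
proof -
  have "lin_form (axis i 1) = (\<Sum>k\<in>UNIV. if k = i then Var k else 0)"
    unfolding lin_form_def by (rule sum.cong) (auto simp: axis_def)
  then show ?thesis by simp
qed

lemma eval_lin_form: "eval_poly (lin_form c) p = (\<Sum>i\<in>UNIV. of_real (c $ i) * p $ i)"
  by (simp add: lin_form_def)

lemma eval_lin_form_complexify [simp]: "eval_poly (lin_form c) (complexify v) = of_real (c \<bullet> v)"
  by (simp add: eval_lin_form complexify_def inner_vec_def)

lemma eval_Nm: "eval_poly Nm p = (\<Sum>i\<in>UNIV. (p $ i)\<^sup>2) - 2"
  by (simp add: Nm_def del: Const_numeral)

lemma eval_Nm_complexify [simp]: "eval_poly Nm (complexify v) = of_real (v \<bullet> v - 2)"
  by (simp add: eval_Nm complexify_def inner_vec_def power2_eq_square)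

text \<open>
  Seven independent vectors orthogonal to \<open>a\<close> form a basis of its orthogonal complement, and the seven generators
  attached to \<open>a\<close> share their last three factors.
\<close>
lemma orthogonal_lin_form_in_ideal:
  fixes a c :: "real ^ 8"
  assumes "a \<noteq> 0" and indep: "inj_on (b a) {1..7} \<and> independent (b a ` {1..7})"
    and orth: "\<And>i. i \<in> {1..7} \<Longrightarrow> b a i \<bullet> a = 0"
    and "a \<in> R" and c: "c \<bullet> a = 0"
  shows "lin_form c * ((lin_form a - 1) * lin_form a * (lin_form a + 1)) \<in> ideal_gen (generators R b)"
proof -
  let ?K = "(lin_form a - 1) * lin_form a * (lin_form a + 1)"
  have "dim {x. a \<bullet> x = 0} = 7"
    using \<open>a \<noteq> 0\<close> by (simp add: dim_hyperplane)
  moreover have "card (b a ` {1..7}) = 7"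
    using indep by (simp add: card_image)
  ultimately have "{x. a \<bullet> x = 0} \<subseteq> span (b a ` {1..7})"
    using indep orth by (intro card_ge_dim_independent) (auto simp: inner_commute)
  then have "c \<in> span (b a ` {1..7})"
    using c by (auto simp: inner_commute)
  then show ?thesis
  proof (induction rule: span_induct_alt)
    case base
    then show ?case by (simp add: ideal_gen_zero)
  next
    case (step r x y)
    then have "lin_form x * ?K \<in> generators R b"
      using \<open>a \<in> R\<close> unfolding generators_def B_set_def by (auto simp: mult.assoc)
    then have "Const (of_real r) * (lin_form x * ?K) \<in> ideal_gen (generators R b)"
      by (rule ideal_gen_mult[OF ideal_gen_base])
    then have "Const (of_real r) * (lin_form x * ?K) + lin_form y * ?K \<in> ideal_gen (generators R b)"
      using step(2) by (rule ideal_gen_add)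
    then show ?case
      by (simp add: lin_form_add lin_form_scaleR distrib_right mult.assoc)
  qed
qed

text \<open>
  For \<open>|a|\<^sup>2 = 2\<close> the vector \<open>2 e\<^sub>i - a\<^sub>i a\<close> is twice the projection of \<open>e\<^sub>i\<close> to the hyperplane orthogonal to \<open>a\<close>. Thus
  the left side is \<open>Y\<close> paired with twice its own projection, and the identity is the theorem of
  Pythagoras.
\<close>
lemma sum_Var_tangential:
  "(\<Sum>i\<in>UNIV. Var i * lin_form (2 *\<^sub>R axis i 1 - (a $ i) *\<^sub>R a)) = 2 * Nm + 4 - lin_form a ^ 2"
proof -
  have "(\<Sum>i\<in>UNIV. Var i * lin_form (2 *\<^sub>R axis i 1 - (a $ i) *\<^sub>R a)) =
    (\<Sum>i\<in>UNIV. 2 * Var i ^ 2 - (Const (of_real (a $ i)) * Var i) * lin_form a)"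
    by (simp add: lin_form_diff lin_form_scaleR algebra_simps power2_eq_square)
  also have "\<dots> = 2 * (\<Sum>i\<in>UNIV. Var i ^ 2) - lin_form a * lin_form a"
    by (simp only: sum_subtractf sum_distrib_left[symmetric] sum_distrib_right[symmetric] lin_form_def[of a, symmetric])
  finally show ?thesis
    by (simp add: Nm_def power2_eq_square)
qed

definition root_values :: "complex set" where
  "root_values = {-2, -1, 0, 1, 2}"

lemma prod_root_values:
  "(\<Prod>v\<in>root_values. f - Const v) = (f + 2) * (f + 1) * f * (f - 1) * (f - 2)"
  by (simp add: root_values_def Const_uminus mult.assoc)

lemma root_polynomial_in_ideal:
  fixes R :: "(real ^ 8) set" and b :: "real ^ 8 \<Rightarrow> nat \<Rightarrow> real ^ 8"
  assumes reps: "antipodal_representatives R"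
    and indep: "\<And>a. a \<in> R \<Longrightarrow> inj_on (b a) {1..7} \<and> independent (b a ` {1..7})"
    and orth: "\<And>a i. a \<in> R \<Longrightarrow> i \<in> {1..7} \<Longrightarrow> b a i \<bullet> a = 0"
    and "a \<in> E8"
  shows "(\<Prod>v\<in>root_values. lin_form a - Const v) \<in> ideal_gen (generators R b)"
proof -
  let ?I = "ideal_gen (generators R b)"
  have rep: "(\<Prod>v\<in>root_values. lin_form a - Const v) \<in> ?I" if "a \<in> R" for a
  proof -
    have a: "a \<in> E8"
      using that reps by (auto simp: antipodal_representatives_def)
    define L where "L = lin_form a"
    define K where "K = (L - 1) * L * (L + 1)"
    have "a \<noteq> 0"
      using E8_norm[OF a] by auto
    have tangential: "lin_form (2 *\<^sub>R axis i 1 - (a $ i) *\<^sub>R a) * K \<in> ?I" for i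
      unfolding K_def L_def
      by (rule orthogonal_lin_form_in_ideal[where a = a and b = b, OF \<open>a \<noteq> 0\<close> indep[OF that] orth[OF that] that])
        (use E8_norm[OF a] in \<open>simp_all add: inner_diff_left inner_axis'\<close>)
    have "(\<Sum>i\<in>UNIV. Var i * (lin_form (2 *\<^sub>R axis i 1 - (a $ i) *\<^sub>R a) * K)) \<in> ?I"
      by (intro ideal_gen_sum ideal_gen_mult tangential)
    then have "(2 * Nm + 4 - L ^ 2) * K \<in> ?I"
      unfolding L_def sum_Var_tangential[symmetric] by (simp add: sum_distrib_right mult.assoc)
    moreover have "Nm \<in> ?I"
      by (rule ideal_gen_base) (simp add: generators_def)
    then have "(2 * K) * Nm \<in> ?I"
      by (rule ideal_gen_mult)
    ultimately have "(2 * K) * Nm - (2 * Nm + 4 - L ^ 2) * K \<in> ?I"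
      by (intro ideal_gen_diff)
    \<comment> \<open>Replacing \<open>|Y|\<^sup>2\<close> by 2 removes \<open>Nm\<close> and leaves \<open>(L\<^sup>2 - 4) K\<close>.\<close>
    also have "(2 * K) * Nm - (2 * Nm + 4 - L ^ 2) * K = (L + 2) * (L + 1) * L * (L - 1) * (L - 2)"
      by (simp add: K_def algebra_simps power2_eq_square)
    finally show ?thesis
      by (simp add: prod_root_values L_def)
  qed
  obtain a' where "a' \<in> R" "a' = a \<or> a' = - a"
    using reps \<open>a \<in> E8\<close> unfolding antipodal_representatives_def by blast
  then consider "a \<in> R" | "- a \<in> R"
    by auto
  then show ?thesis
  proof cases
    case 1
    then show ?thesis by (rule rep)
  next
    case 2
    have "(\<Prod>v\<in>root_values. lin_form a - Const v) = - 1 * (\<Prod>v\<in>root_values. lin_form (- a) - Const v)"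
      unfolding prod_root_values lin_form_uminus by (simp add: algebra_simps)
    then show ?thesis
      using ideal_gen_mult[OF rep[OF 2], of "- 1"] by (simp only:)
  qed
qed

lemma Var_eq_root_forms: "2 * Var i = lin_form (axis i 1 + axis k 1) + lin_form (axis i 1 - axis k 1)"
  by (simp add: lin_form_add lin_form_diff)

text \<open>
  With \<open>e\<^sub>i + e\<^sub>k\<close> and \<open>e\<^sub>i - e\<^sub>k\<close> fixed to the values \<open>u\<close> and \<open>w\<close>, the coordinate \<open>Y\<^sub>i\<close> takes the value \<open>(u + w) / 2\<close>.
\<close>
lemma coordinate_polynomial_in_ideal:
  assumes "\<And>a. a \<in> E8 \<Longrightarrow> (\<Prod>v\<in>root_values. lin_form a - Const v) \<in> ideal_gen S"
  shows "\<exists>V. finite V \<and> (\<Prod>v\<in>V. Var i - Const v) \<in> ideal_gen S"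
proof -
  obtain k where k: "i \<noteq> k"
    using other_index by blast
  define L M where "L = lin_form (axis i 1 + axis k 1)" and "M = lin_form (axis i 1 - axis k 1)"
  define V where "V = (\<lambda>(u, w). (u + w) / 2) ` (root_values \<times> root_values)"
  have fin: "finite root_values"
    by (simp add: root_values_def)
  then have "finite V"
    by (simp add: V_def)
  have L: "(\<Prod>v\<in>root_values. L - Const v) \<in> ideal_gen S"
    unfolding L_def by (rule assms[OF root_add[OF k]])
  have M: "(\<Prod>v\<in>root_values. M - Const v) \<in> ideal_gen S"
    unfolding M_def by (rule assms[OF root_diff[OF k]])
  have "(\<Prod>v\<in>V. Var i - Const v) \<in> ideal_gen S"
  proof (rule ideal_split[OF fin L])
    fix u assume u: "u \<in> root_values"
    show "(\<Prod>v\<in>V. Var i - Const v) \<in> ideal_gen (insert (L - Const u) S)"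
    proof (rule ideal_split[OF fin])
      show "(\<Prod>v\<in>root_values. M - Const v) \<in> ideal_gen (insert (L - Const u) S)"
        using M ideal_gen_mono[OF subset_insertI] by blast
    next
      fix w assume w: "w \<in> root_values"
      let ?T = "insert (M - Const w) (insert (L - Const u) S)"
      let ?v = "(u + w) / 2"
      have "(L - Const u) + (M - Const w) \<in> ideal_gen ?T"
        by (intro ideal_gen_add ideal_gen_base) auto
      also have "(L - Const u) + (M - Const w) = Const 2 * Var i - Const (u + w)"
        using Var_eq_root_forms[of i k] by (simp add: L_def M_def Const_add)
      also have "\<dots> = Const 2 * (Var i - Const ?v)"
        unfolding right_diff_distrib Const_mult[symmetric]
        by (metis nonzero_mult_div_cancel_left times_divide_eq_right zero_neq_numeral)
      finally have "Var i - Const ?v \<in> ideal_gen ?T"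
        by (rule ideal_gen_Const_multD) simp
      then have "(\<Prod>v\<in>V - {?v}. Var i - Const v) * (Var i - Const ?v) \<in> ideal_gen ?T"
        by (rule ideal_gen_mult)
      moreover have "?v \<in> V"
        using u w by (auto simp: V_def)
      ultimately show "(\<Prod>v\<in>V. Var i - Const v) \<in> ideal_gen ?T"
        by (simp add: prod.remove[OF \<open>finite V\<close>] mult.commute)
    qed
  qed
  with \<open>finite V\<close> show ?thesis by blast
qed

text \<open>
  A root \<open>p\<close> has inner product \<open>-1\<close>, \<open>0\<close> or \<open>1\<close> with \<open>a\<close>, or it is \<open>\<plusminus>a\<close> and hence orthogonal to every \<open>b a i\<close>.
\<close>
lemma complexify_E8_subset_zero_locus:
  assumes "R \<subseteq> E8" and orth: "\<And>a i. a \<in> R \<Longrightarrow> i \<in> {1..7} \<Longrightarrow> b a i \<bullet> a = 0"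
  shows "complexify ` E8 \<subseteq> zero_locus (generators R b)"
proof -
  have "eval_poly f (complexify p) = 0" if "p \<in> E8" "f \<in> generators R b" for p f
    using that(2) unfolding generators_def
  proof (elim insertE UN_E)
    assume "f = Nm"
    then show ?thesis
      using E8_norm[OF that(1)] by simp
  next
    fix a assume a: "a \<in> R" "f \<in> B_set a (b a)"
    then obtain i where i: "i \<in> {1..7}"
      and f: "f = lin_form (b a i) * (lin_form a - 1) * lin_form a * (lin_form a + 1)"
      by (auto simp: B_set_def)
    have "b a i \<bullet> a = 0"
      using orth a(1) i by blast
    moreover have "a \<bullet> p \<in> {-1, 0, 1} \<or> p = a \<or> p = - a"
      using E8_inner_cases that(1) a(1) assms(1) by blast
    ultimately show ?thesis
      by (auto simp: f)
  qed
  then show ?thesis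
    by (auto simp: zero_locus_def)
qed

text \<open>
  A zero is real because its coordinates are half-sums of values of root forms; its inner products with
  all roots are then integers, and self-duality of the lattice applies.
\<close>
lemma zero_locus_subset_complexify_E8:
  assumes root: "\<And>a. a \<in> E8 \<Longrightarrow> (\<Prod>v\<in>root_values. lin_form a - Const v) \<in> ideal_gen S"
    and "Nm \<in> S"
  shows "zero_locus S \<subseteq> complexify ` E8"
proof
  fix p assume p: "p \<in> zero_locus S"
  have val: "eval_poly (lin_form a) p \<in> root_values" if "a \<in> E8" for a
  proof -
    have "eval_poly (\<Prod>v\<in>root_values. lin_form a - Const v) p = 0"
      using root[OF that] p by (rule eval_poly_ideal_gen)
    then show ?thesis
      unfolding prod_root_values by (auto simp: root_values_def eq_neg_iff_add_eq_0)
  qed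
  have root_real: "z \<in> \<real>" if "z \<in> root_values" for z
    using that by (auto simp: root_values_def)
  have real: "p $ i \<in> \<real>" for i
  proof -
    obtain k where k: "i \<noteq> k"
      using other_index by blast
    have "2 * p $ i = eval_poly (2 * Var i) p"
      by simp
    also have "\<dots> = eval_poly (lin_form (axis i 1 + axis k 1)) p + eval_poly (lin_form (axis i 1 - axis k 1)) p"
      by (simp only: Var_eq_root_forms[of i k] eval_poly_add)
    also have "\<dots> \<in> \<real>"
      by (intro Reals_add root_real val root_add root_diff k)
    finally have "(2 * p $ i) / 2 \<in> \<real>"
      by (rule Reals_divide) simp
    then show ?thesis by simp
  qed
  define v where "v = (\<chi> i. Re (p $ i))"
  have p_eq: "p = complexify v"
    using real by (simp add: v_def complexify_def vec_eq_iff)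
  have "v \<in> E8"
  proof (rule E8_if_integral)
    show "a \<bullet> v \<in> \<int>" if "a \<in> E8" for a
    proof -
      have "complex_of_real (a \<bullet> v) \<in> root_values"
        using val[OF that] by (simp add: p_eq)
      then have "complex_of_real (a \<bullet> v) \<in> complex_of_real ` {-2, -1, 0, 1, 2}"
        by (simp add: root_values_def)
      then have "a \<bullet> v \<in> {-2, -1, 0, 1, 2}"
        unfolding inj_image_mem_iff[OF inj_of_real] .
      then show ?thesis by auto
    qed
  next
    have "complex_of_real (v \<bullet> v - 2) = 0"
      using p \<open>Nm \<in> S\<close> unfolding p_eq zero_locus_def eval_Nm_complexify[symmetric] by blast
    then show "v \<bullet> v = 2"
      unfolding of_real_eq_0_iff by simp
  qed
  then show "p \<in> complexify ` E8"
    by (simp add: p_eq)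
qed

text \<open>
  The polynomial is \<open>z\<^sup>5 - 5 z\<^sup>3 + 4 z\<close> in \<open>z = a \<cdot> Y\<close>. Its derivative is 24, -6, 4, -6, 24 at the roots
  \<open>-2, \<dots>, 2\<close>.
\<close>
lemma jacobian_row_root_polynomial:
  assumes "a \<in> E8" "x \<in> E8"
  shows "\<exists>c. c \<noteq> 0 \<and> jacobian_row (\<Prod>v\<in>root_values. lin_form a - Const v) (complexify x) = c *s complexify a"
proof -
  define z where "z = complex_of_real (a \<bullet> x)"
  define c where "c = 5 * z ^ 4 - 15 * z\<^sup>2 + 4"
  have "a \<bullet> x \<in> {-2, -1, 0, 1, 2}"
    using E8_inner_cases[OF assms] E8_norm[OF assms(1)] by auto
  then have "c \<noteq> 0"
    by (auto simp: c_def z_def)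
  moreover have "jacobian_row (\<Prod>v\<in>root_values. lin_form a - Const v) (complexify x) = c *s complexify a"
  proof (rule jacobian_row_eqI)
    fix j
    let ?\<alpha> = "complex_of_real (a $ j)"
    have form: "eval_poly (lin_form a) (complexify x + t *s axis j 1) = z + t * ?\<alpha>" for t
    proof -
      have "eval_poly (lin_form a) (complexify x + t *s axis j 1) =
          (\<Sum>i\<in>UNIV. of_real (a $ i) * complexify x $ i + (if i = j then t * ?\<alpha> else 0))"
        unfolding eval_lin_form by (rule sum.cong) (auto simp: axis_def algebra_simps)
      also have "\<dots> = z + t * ?\<alpha>"
        using eval_lin_form_complexify[of a x] by (simp add: sum.distrib eval_lin_form z_def)
      finally show ?thesis .
    qed
    have "(w + 2) * (w + 1) * w * (w - 1) * (w - 2) = w ^ 5 - 5 * w ^ 3 + 4 * w" for w :: complex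
      by (simp add: algebra_simps eval_nat_numeral)
    then have expand: "eval_poly (\<Prod>v\<in>root_values. lin_form a - Const v) (complexify x + t *s axis j 1) =
       (z + t * ?\<alpha>) ^ 5 - 5 * (z + t * ?\<alpha>) ^ 3 + 4 * (z + t * ?\<alpha>)" for t
      unfolding prod_root_values by (simp add: form)
    show "((\<lambda>t. eval_poly (\<Prod>v\<in>root_values. lin_form a - Const v) (complexify x + t *s axis j 1))
        has_field_derivative (c *s complexify a) $ j) (at 0)"
      unfolding expand by (auto intro!: derivative_eq_intros simp: c_def complexify_def algebra_simps)
  qed
  ultimately show ?thesis by blast
qed

lemma jacobian_rank_full:
  assumes root: "\<And>a. a \<in> E8 \<Longrightarrow> (\<Prod>v\<in>root_values. lin_form a - Const v) \<in> ideal_gen S"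
    and "x \<in> E8" "complexify x \<in> zero_locus S"
  shows "jacobian_rank S (complexify x) = 8"
proof -
  let ?W = "vec.span ((\<lambda>g. jacobian_row g (complexify x)) ` S)"
  have root_W: "complexify a \<in> ?W" if a: "a \<in> E8" for a
  proof -
    obtain c where "c \<noteq> 0"
      "jacobian_row (\<Prod>v\<in>root_values. lin_form a - Const v) (complexify x) = c *s complexify a"
      using jacobian_row_root_polynomial[OF a \<open>x \<in> E8\<close>] by blast
    then have "c *s complexify a \<in> ?W"
      using jacobian_row_ideal_gen[OF root[OF a] assms(3)] by simp
    then have "(1 / c) *s (c *s complexify a) \<in> ?W"
      by (rule vec.span_scale)
    then show ?thesis
      using \<open>c \<noteq> 0\<close> by simp
  qed
  have axis_W: "axis i 1 \<in> ?W" for i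
  proof -
    obtain k where k: "i \<noteq> k"
      using other_index by blast
    have "(1 / 2) *s (complexify (axis i 1 + axis k 1) + complexify (axis i 1 - axis k 1)) \<in> ?W"
      by (intro vec.span_scale vec.span_add root_W root_add root_diff k)
    also have "(1 / 2) *s (complexify (axis i 1 + axis k 1) + complexify (axis i 1 - axis k 1)) = axis i 1"
      by (simp add: vec_eq_iff complexify_def axis_def)
    finally show ?thesis .
  qed
  have "w \<in> ?W" for w :: "complex ^ 8"
  proof -
    have "(\<Sum>i\<in>UNIV. w $ i *s axis i 1) \<in> ?W"
      by (intro vec.span_sum vec.span_scale axis_W)
    then show ?thesis
      by (simp add: basis_expansion)
  qed
  then have "?W = UNIV"
    by blast
  then show ?thesis
    using vec.dim_span[of "(\<lambda>g. jacobian_row g (complexify x)) ` S"] vec_dim_card[where 'a = complex and 'n = 8]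
    by (simp add: jacobian_rank_def)
qed

section \<open>Forms vanishing on the roots\<close>

definition bil :: "('n::finite \<Rightarrow> 'n \<Rightarrow> complex) \<Rightarrow> real ^ 'n \<Rightarrow> real ^ 'n \<Rightarrow> complex" where
  "bil q x y = (\<Sum>i\<in>UNIV. \<Sum>j\<in>UNIV. q i j * of_real (x $ i) * of_real (y $ j))"

definition tri :: "('n::finite \<Rightarrow> 'n \<Rightarrow> 'n \<Rightarrow> complex) \<Rightarrow> real ^ 'n \<Rightarrow> real ^ 'n \<Rightarrow> real ^ 'n \<Rightarrow> complex" where
  "tri c x y z = (\<Sum>i\<in>UNIV. \<Sum>j\<in>UNIV. \<Sum>k\<in>UNIV.
     c i j k * of_real (x $ i) * of_real (y $ j) * of_real (z $ k))"

lemma bil_linear: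
  "bil q (x + y) z = bil q x z + bil q y z" "bil q z (x + y) = bil q z x + bil q z y"
  "bil q (x - y) z = bil q x z - bil q y z" "bil q z (x - y) = bil q z x - bil q z y"
  by (simp_all add: bil_def algebra_simps sum.distrib sum_subtractf)

lemma tri_linear:
  "tri c (x + y) z w = tri c x z w + tri c y z w"
  "tri c z (x + y) w = tri c z x w + tri c z y w"
  "tri c z w (x + y) = tri c z w x + tri c z w y"
  "tri c (x - y) z w = tri c x z w - tri c y z w"
  "tri c z (x - y) w = tri c z x w - tri c z y w"
  "tri c z w (x - y) = tri c z w x - tri c z w y"
  by (simp_all add: tri_def algebra_simps sum.distrib sum_subtractf)

lemma sum_axis:
  "(\<Sum>i\<in>UNIV. f i * of_real (axis k 1 $ i)) = (f k :: complex)"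
proof -
  have "(\<Sum>i\<in>UNIV. f i * of_real (axis k 1 $ i)) = (\<Sum>i\<in>UNIV. if i = k then f i else 0)"
    by (rule sum.cong) (auto simp: axis_def)
  then show ?thesis by simp
qed

lemma bil_axis [simp]: "bil q (axis i 1) (axis j 1) = q i j"
  unfolding bil_def sum_axis ..

lemma tri_axis [simp]: "tri c (axis i 1) (axis j 1) (axis k 1) = c i j k"
  unfolding tri_def sum_axis ..

lemma tri_swap12:
  assumes "\<And>i j k. c j i k = c i j k"
  shows "tri c y x z = tri c x y z"
  unfolding tri_def by (subst sum.swap) (simp add: assms mult_ac)

lemma tri_swap23:
  assumes "\<And>i j k. c i k j = c i j k"
  shows "tri c x z y = tri c x y z"
  unfolding tri_def by (rule sum.cong, rule refl, subst sum.swap) (simp add: assms mult_ac)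

text \<open>
  The roots \<open>e\<^sub>i + e\<^sub>j\<close> and \<open>e\<^sub>i - e\<^sub>j\<close> give \<open>q i j = 0\<close> and \<open>q i i = - q j j\<close>. Comparing three indices makes the diagonal
  vanish.
\<close>
lemma quadratic_vanishing_on_E8:
  assumes sym: "\<And>i j. q j i = q i j" and zero: "\<And>x. x \<in> E8 \<Longrightarrow> bil q x x = 0"
  shows "q i j = 0"
proof -
  have plus: "q i i + q j j + 2 * q i j = 0" if "i \<noteq> j" for i j
    using zero[OF root_add[OF that]] sym[of j i] by (simp add: bil_linear algebra_simps)
  have minus: "q i i + q j j - 2 * q i j = 0" if "i \<noteq> j" for i j
    using zero[OF root_diff[OF that]] sym[of j i] by (simp add: bil_linear algebra_simps)
  have off: "q i j = 0" and diag: "q i i = - q j j" if "i \<noteq> j" for i j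
  proof -
    have "4 * q i j = (q i i + q j j + 2 * q i j) - (q i i + q j j - 2 * q i j)"
      by simp
    also have "\<dots> = 0"
      by (simp only: plus[OF that] minus[OF that] diff_self)
    finally show "q i j = 0"
      by simp
    then show "q i i = - q j j"
      using plus[OF that] by (simp add: eq_neg_iff_add_eq_0)
  qed
  obtain k where k: "i \<noteq> k"
    using other_index by blast
  obtain l where "l \<notin> set [i, k]"
    using ex_other_index[of "[i, k]"] by auto
  then have "q i i = - q i i"
    using diag[OF k] diag[of k l] diag[of i l] by auto
  then have "q i i = 0"
    by simp
  then show ?thesis
    using off by (cases "i = j") auto
qed

text \<open>
  The polarization identity: the third difference of a cubic form in the directions \<open>a\<close>, \<open>b\<close>, \<open>d\<close> is constant.
\<close>
lemma third_difference:
  assumes "\<And>i j k. c j i k = c i j k" "\<And>i j k. c i k j = c i j k"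
  shows "tri c x x x - tri c (x - a) (x - a) (x - a) - tri c (x - b) (x - b) (x - b)
     - tri c (x - d) (x - d) (x - d) + tri c (x - a - b) (x - a - b) (x - a - b)
     + tri c (x - a - d) (x - a - d) (x - a - d) + tri c (x - b - d) (x - b - d) (x - b - d)
     - tri c (x - a - b - d) (x - a - b - d) (x - a - b - d) = 6 * tri c a b d"
proof -
  note swap = tri_swap12[of c, OF assms(1)] tri_swap23[of c, OF assms(2)]
  have "tri c b a d = tri c a b d" "tri c a d b = tri c a b d" "tri c d a b = tri c a b d"
    "tri c b d a = tri c a b d" "tri c d b a = tri c a b d"
    by (metis swap)+
  then show ?thesis
    by (simp add: tri_linear)
qed

text \<open>
  Subtracting from \<open>x\<close> a root with which it has inner product 1 gives a root. Orthogonality keeps the inner products with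
  the other two roots, so all eight vertices in the third difference are roots.
\<close>
lemma tri_orthogonal_roots:
  assumes sym: "\<And>i j k. c j i k = c i j k" "\<And>i j k. c i k j = c i j k"
    and zero: "\<And>x. x \<in> E8 \<Longrightarrow> tri c x x x = 0"
    and roots: "x \<in> E8" "a \<in> E8" "b \<in> E8" "d \<in> E8"
    and orth: "a \<bullet> b = 0" "a \<bullet> d = 0" "b \<bullet> d = 0"
    and one: "a \<bullet> x = 1" "b \<bullet> x = 1" "d \<bullet> x = 1"
  shows "tri c a b d = 0"
proof -
  have "x - a \<in> E8" "x - b \<in> E8" "x - d \<in> E8"
    using roots one by (auto intro: E8_diff)
  moreover from this have "x - a - b \<in> E8" "x - a - d \<in> E8" "x - b - d \<in> E8"
    using roots one orth by (auto intro!: E8_diff simp: inner_diff_right inner_commute)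
  moreover from this have "x - a - b - d \<in> E8"
    using roots one orth by (auto intro!: E8_diff simp: inner_diff_right inner_commute)
  ultimately have "6 * tri c a b d = 0"
    using zero roots unfolding third_difference[of c x a b d, OF sym, symmetric] by simp
  then show ?thesis by simp
qed

text \<open>
  The signs at three positions can be prescribed, since a fourth position can restore the parity.
\<close>
lemma half_root_with_signs:
  fixes i' j' k' m' :: 8
  assumes "distinct [i', j', k', m']" "s \<in> {1, -1}" "t \<in> {1, -1}" "u \<in> {1, -1}"
  shows "(\<chi> r. if r = i' then s / 2 else if r = j' then t / 2 else if r = k' then u / 2
           else if r = m' then s * t * u / 2 else 1 / 2) \<in> E8" (is "?x \<in> E8")
proof -
  let ?N = "\<lambda>e r. if e = (- 1 :: real) then {r :: 8} else {}"
  have "{r. ?x $ r = -1/2} = ?N s i' \<union> ?N t j' \<union> ?N u k' \<union> ?N (s * t * u) m'"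
    using assms by auto
  moreover have "even (card (?N s i' \<union> ?N t j' \<union> ?N u k' \<union> ?N (s * t * u) m'))"
    using assms by auto
  moreover have "?x $ r \<in> {1/2, -1/2}" for r
    using assms by auto
  ultimately show ?thesis
    unfolding E8_def by simp
qed

text \<open>
  The roots \<open>e\<^sub>i \<plusminus> e\<^sub>i\<^sub>'\<close>, \<open>e\<^sub>j \<plusminus> e\<^sub>j\<^sub>'\<close>, \<open>e\<^sub>k \<plusminus> e\<^sub>k\<^sub>'\<close> with six distinct indices and any choice of the three signs are
  orthogonal, and some half-integral root \<open>x\<close> has inner product 1 with all of them. Summing over the two signs in each argument isolates
  \<open>(e\<^sub>i, e\<^sub>j, e\<^sub>k)\<close>.
\<close>
lemma cubic_off_diagonal:
  fixes c :: "8 \<Rightarrow> 8 \<Rightarrow> 8 \<Rightarrow> complex"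
  assumes sym: "\<And>i j k. c j i k = c i j k" "\<And>i j k. c i k j = c i j k"
    and zero: "\<And>x. x \<in> E8 \<Longrightarrow> tri c x x x = 0"
    and dist: "i \<noteq> j" "i \<noteq> k" "j \<noteq> k"
  shows "c i j k = 0"
proof -
  obtain i' where i': "i' \<notin> set [i, j, k]"
    using ex_other_index[of "[i, j, k]"] by auto
  obtain j' where j': "j' \<notin> set [i, j, k, i']"
    using ex_other_index[of "[i, j, k, i']"] by auto
  obtain k' where k': "k' \<notin> set [i, j, k, i', j']"
    using ex_other_index[of "[i, j, k, i', j']"] by auto
  obtain m' where m': "m' \<notin> set [i, j, k, i', j', k']"
    using ex_other_index[of "[i, j, k, i', j', k']"] by auto
  have signs: "tri c (1 *\<^sub>R axis i 1 + s *\<^sub>R axis i' 1) (1 *\<^sub>R axis j 1 + t *\<^sub>R axis j' 1)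
      (1 *\<^sub>R axis k 1 + u *\<^sub>R axis k' 1) = 0"
    if stu: "s \<in> {1, -1}" "t \<in> {1, -1}" "u \<in> {1, -1}" for s t u
  proof -
    have ne: "i \<noteq> i'" "j \<noteq> j'" "k \<noteq> k'" "distinct [i', j', k', m']"
      using i' j' k' m' by auto
    show ?thesis
    proof (rule tri_orthogonal_roots[OF sym zero half_root_with_signs[OF ne(4) stu]
          pair_root[OF ne(1) _ stu(1)] pair_root[OF ne(2) _ stu(2)] pair_root[OF ne(3) _ stu(3)]])
    qed (unfold inner_pair, use stu i' j' k' m' dist in \<open>auto simp: axis_def\<close>)
  qed
  have signs': "tri c (axis i 1 + axis i' 1) y z = 0 \<and> tri c (axis i 1 - axis i' 1) y z = 0"
    if "y \<in> {axis j 1 + axis j' 1, axis j 1 - axis j' 1}" "z \<in> {axis k 1 + axis k' 1, axis k 1 - axis k' 1}"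
    for y z
    using that signs[of 1 1 1] signs[of 1 1 "-1"] signs[of 1 "-1" 1] signs[of 1 "-1" "-1"]
      signs[of "-1" 1 1] signs[of "-1" 1 "-1"] signs[of "-1" "-1" 1] signs[of "-1" "-1" "-1"]
    by auto
  have half: "2 * tri c (axis i 1) y z = tri c (axis i 1 + axis i' 1) y z + tri c (axis i 1 - axis i' 1) y z"
    "2 * tri c w (axis j 1) z = tri c w (axis j 1 + axis j' 1) z + tri c w (axis j 1 - axis j' 1) z"
    "2 * tri c w y (axis k 1) = tri c w y (axis k 1 + axis k' 1) + tri c w y (axis k 1 - axis k' 1)" for w y z
    by (simp_all add: tri_linear)
  have 1: "tri c (axis i 1) y z = 0"
    if "y \<in> {axis j 1 + axis j' 1, axis j 1 - axis j' 1}" "z \<in> {axis k 1 + axis k' 1, axis k 1 - axis k' 1}" for y z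
    using half(1)[of y z] signs'[OF that] by simp
  have 2: "tri c (axis i 1) (axis j 1) z = 0"
    if "z \<in> {axis k 1 + axis k' 1, axis k 1 - axis k' 1}" for z
    using half(2)[of "axis i 1" z] 1[OF _ that] by simp
  show ?thesis
    using half(3)[of "axis i 1" "axis j 1"] 2 by simp
qed

text \<open>
  Write \<open>\<alpha>\<^sub>i\<close> for the coefficient of \<open>x\<^sub>i\<^sup>3\<close>. The roots \<open>e\<^sub>i \<plusminus> e\<^sub>j\<close> determine the coefficients with a repeated index, and
  the form is \<open>2 \<Sum>\<alpha>\<^sub>i x\<^sub>i\<^sup>3 - A(x) |x|\<^sup>2\<close> with \<open>A(x) = \<Sum>\<alpha>\<^sub>i x\<^sub>i\<close>. On a half-integral root this is
  \<open>A(x) / 2 - 2 A(x)\<close>, so \<open>A\<close> vanishes there. Two such roots differ by \<open>e\<^sub>i + e\<^sub>j\<close>, whence \<open>\<alpha>\<^sub>i + \<alpha>\<^sub>j = 0\<close> for all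
  \<open>i \<noteq> j\<close>.
\<close>
lemma cubic_vanishing_on_E8:
  fixes c :: "8 \<Rightarrow> 8 \<Rightarrow> 8 \<Rightarrow> complex"
  assumes sym: "\<And>i j k. c j i k = c i j k" "\<And>i j k. c i k j = c i j k"
    and zero: "\<And>x. x \<in> E8 \<Longrightarrow> tri c x x x = 0"
  shows "c i j k = 0"
proof -
  define \<alpha> where "\<alpha> i = c i i i" for i
  have edge: "c i j j = - \<alpha> i / 3" if "i \<noteq> j" for i j
  proof -
    have "tri c (axis i 1 + axis j 1) (axis i 1 + axis j 1) (axis i 1 + axis j 1)
        + tri c (axis i 1 - axis j 1) (axis i 1 - axis j 1) (axis i 1 - axis j 1)
        = 2 * (\<alpha> i + 3 * c i j j)"
      using sym(1)[of i j j] sym(2)[of j j i] by (simp add: tri_linear \<alpha>_def)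
    then have "2 * (\<alpha> i + 3 * c i j j) = 0"
      by (simp only: zero[OF root_add[OF that]] zero[OF root_diff[OF that]] add_0)
    then have "\<alpha> i + 3 * c i j j = 0"
      unfolding mult_eq_0_iff by simp
    then show ?thesis
      by (simp add: eq_neg_iff_add_eq_0 field_simps)
  qed
  have c_eq: "c i j k = (if i = j \<and> j = k then 2 * \<alpha> i else 0)
      - ((if j = k then \<alpha> i else 0) + (if i = k then \<alpha> j else 0) + (if i = j then \<alpha> k else 0)) / 3" for i j k
  proof -
    consider "i = j" "j = k" | "i = j" "j \<noteq> k" | "i \<noteq> j" "j = k" | "i \<noteq> j" "i = k"
      | "i \<noteq> j" "i \<noteq> k" "j \<noteq> k" by blast
    then show ?thesis
    proof cases
      case 1
      then show ?thesis by (simp add: \<alpha>_def)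
    next
      case 2
      then show ?thesis
        using edge[of k j] sym(1)[of k j j] sym(2)[of j j k] by simp
    next
      case 3
      then show ?thesis
        using edge[of i j] by simp
    next
      case 4
      then show ?thesis
        using edge[of j i] sym(1)[of j i i] by simp
    next
      case 5
      then show ?thesis
        using cubic_off_diagonal[OF sym zero] by simp
    qed
  qed
  define A where "A x = (\<Sum>i\<in>UNIV. \<alpha> i * of_real (x $ i))" for x :: "real ^ 8"
  have A_half: "A x = 0" if "x \<in> E8" "\<forall>i. (x $ i)\<^sup>2 = 1/4" for x
  proof -
    let ?X = "\<lambda>i. complex_of_real (x $ i)"
    have sq: "?X i * ?X i = 1/4" for i
      using that(2)[rule_format, of i] by (metis of_real_1 of_real_divide of_real_mult of_real_numeral power2_eq_square)
    have "0 = tri c x x x"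
      using zero[OF that(1)] by simp
    also have "\<dots> = (\<Sum>i\<in>UNIV. \<Sum>j\<in>UNIV. \<Sum>k\<in>UNIV. (if k = j then (if j = i then 2 * \<alpha> i * ?X i * ?X i * ?X i else 0) else 0)
        - (if k = j then \<alpha> i * ?X i * ?X j * ?X j else 0) / 3
        - (if k = i then \<alpha> j * ?X j * ?X i * ?X i else 0) / 3
        - (if j = i then \<alpha> k * ?X k * ?X i * ?X i else 0) / 3)"
      unfolding tri_def by (intro sum.cong refl) (subst c_eq, auto simp: algebra_simps)
    also have "\<dots> = (\<Sum>i\<in>UNIV. 2 * \<alpha> i * ?X i * ?X i * ?X i)
        - (\<Sum>i\<in>UNIV. \<Sum>j\<in>UNIV. \<alpha> i * ?X i * ?X j * ?X j) / 3
        - (\<Sum>i\<in>UNIV. \<Sum>j\<in>UNIV. \<alpha> j * ?X j * ?X i * ?X i) / 3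
        - (\<Sum>i\<in>UNIV. \<Sum>k\<in>UNIV. \<alpha> k * ?X k * ?X i * ?X i) / 3"
    proof -
      have "(\<Sum>j\<in>UNIV. \<Sum>k\<in>UNIV. if j = i then \<alpha> k * ?X k * ?X i * ?X i else 0)
          = (\<Sum>k\<in>UNIV. \<alpha> k * ?X k * ?X i * ?X i)" for i
        by (subst sum.swap) simp
      then show ?thesis
        by (simp add: sum_subtractf sum_divide_distrib[symmetric]) (simp add: sum_distrib_left)
    qed
    also have "(\<Sum>i\<in>UNIV. 2 * \<alpha> i * ?X i * ?X i * ?X i) = A x / 2"
      unfolding A_def sum_divide_distrib by (rule sum.cong) (simp_all add: mult.assoc sq)
    also have "(\<Sum>i\<in>UNIV. \<Sum>j\<in>UNIV. \<alpha> i * ?X i * ?X j * ?X j) = 2 * A x"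
      unfolding A_def sum_distrib_left by (rule sum.cong) (simp_all add: mult.assoc sq)
    also have "(\<Sum>i\<in>UNIV. \<Sum>j\<in>UNIV. \<alpha> j * ?X j * ?X i * ?X i) = 2 * A x"
      by (simp add: mult.assoc sq sum_divide_distrib[symmetric] A_def)
    finally show ?thesis by simp
  qed
  have pair: "\<alpha> i + \<alpha> j = 0" if "i \<noteq> j" for i j
  proof -
    define x :: "real ^ 8" where "x = (\<chi> r. 1/2)"
    have x: "x \<in> E8"
      by (simp add: E8_def x_def)
    have "(axis i 1 + axis j 1) \<bullet> x = 1"
      by (simp add: inner_add_left inner_axis' x_def)
    then have "x - (axis i 1 + axis j 1) \<in> E8"
      using x root_add[OF that] by (intro E8_diff)
    then have "A (x - (axis i 1 + axis j 1)) = 0"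
      using that by (intro A_half) (auto simp: x_def axis_def power2_eq_square)
    moreover have "A x = 0"
      using x by (intro A_half) (auto simp: x_def power2_eq_square)
    moreover have "A (x - (axis i 1 + axis j 1)) = A x - (\<alpha> i + \<alpha> j)"
      by (simp add: A_def right_diff_distrib distrib_left sum_subtractf sum.distrib sum_axis)
    ultimately show ?thesis
      by (metis diff_0 neg_equal_0_iff_equal)
  qed
  have "\<alpha> i = 0" for i
  proof -
    obtain k where k: "i \<noteq> k"
      using other_index by blast
    obtain l where "l \<notin> set [i, k]"
      using ex_other_index[of "[i, k]"] by auto
    then have "i \<noteq> l" "k \<noteq> l"
      by auto
    have "2 * \<alpha> i = (\<alpha> i + \<alpha> k) + (\<alpha> i + \<alpha> l) - (\<alpha> k + \<alpha> l)"
      by simp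
    then show ?thesis
      using pair[OF k] pair[OF \<open>i \<noteq> l\<close>] pair[OF \<open>k \<noteq> l\<close>] by simp
  qed
  then show ?thesis
    by (subst c_eq) simp
qed

section \<open>Polynomials of degree at most three\<close>

lemma cubic_decomposition:
  fixes f :: "'v::finite cpoly"
  assumes "total_degree f \<le> 3"
  obtains c l q t where "f = Const c + (\<Sum>i\<in>UNIV. Var i * (Const (l i)
     + (\<Sum>j\<in>UNIV. Var j * (Const (q i j) + (\<Sum>k\<in>UNIV. Var k * Const (t i j k))))))"
proof -
  obtain c g where f: "f = Const c + (\<Sum>i\<in>UNIV. Var i * g i)" and g: "\<And>i. total_degree (g i) \<le> 2"
    using degree_decomposition[of f 2] assms by auto
  have "\<forall>i. \<exists>l h. g i = Const l + (\<Sum>j\<in>UNIV. Var j * h j) \<and> (\<forall>j. total_degree (h j) \<le> 1)"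
    using degree_decomposition[of _ 1] g by (metis Suc_1)
  then obtain l h where g_eq: "\<And>i. g i = Const (l i) + (\<Sum>j\<in>UNIV. Var j * h i j)"
    and h: "\<And>i j. total_degree (h i j) \<le> 1"
    by metis
  have "\<forall>i j. \<exists>q r. h i j = Const q + (\<Sum>k\<in>UNIV. Var k * r k) \<and> (\<forall>k. total_degree (r k) \<le> 0)"
    using degree_decomposition[of _ 0] h by (metis One_nat_def)
  then obtain q r where h_eq: "\<And>i j. h i j = Const (q i j) + (\<Sum>k\<in>UNIV. Var k * r i j k)"
    and r: "\<And>i j k. total_degree (r i j k) \<le> 0"
    by metis
  have "\<forall>i j k. \<exists>t. r i j k = Const t"
    using total_degree_0_Const[OF r] by metis
  then obtain t where "\<And>i j k. r i j k = Const (t i j k)"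
    by metis
  then show ?thesis
    using that f g_eq h_eq by simp
qed

lemma sum_symmetrize2:
  fixes v :: "'n::finite \<Rightarrow> 'a::comm_ring_1"
  shows "(\<Sum>i\<in>UNIV. \<Sum>j\<in>UNIV. (q i j + q j i) * v i * v j) = 2 * (\<Sum>i\<in>UNIV. \<Sum>j\<in>UNIV. q i j * v i * v j)"
proof -
  have "(\<Sum>i\<in>UNIV. \<Sum>j\<in>UNIV. q j i * v i * v j) = (\<Sum>i\<in>UNIV. \<Sum>j\<in>UNIV. q i j * v i * v j)"
    by (subst sum.swap) (simp add: mult_ac)
  then show ?thesis
    by (simp add: distrib_right sum.distrib)
qed

lemma sum_symmetrize3:
  fixes v :: "'n::finite \<Rightarrow> 'a::comm_ring_1"
  shows "(\<Sum>i\<in>UNIV. \<Sum>j\<in>UNIV. \<Sum>k\<in>UNIV.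
      (c i j k + c i k j + c j i k + c j k i + c k i j + c k j i) * v i * v j * v k) =
    6 * (\<Sum>i\<in>UNIV. \<Sum>j\<in>UNIV. \<Sum>k\<in>UNIV. c i j k * v i * v j * v k)"
proof -
  define F where "F c = (\<Sum>i\<in>UNIV. \<Sum>j\<in>UNIV. \<Sum>k\<in>UNIV. c i j k * v i * v j * v k)" for c
  have s12: "F (\<lambda>i j k. c j i k) = F c" for c
    unfolding F_def by (subst sum.swap) (simp add: mult_ac)
  have s23: "F (\<lambda>i j k. c i k j) = F c" for c
    unfolding F_def by (rule sum.cong, rule refl, subst sum.swap) (simp add: mult_ac)
  have "F (\<lambda>i j k. c j k i) = F c"
    using s12[of "\<lambda>i j k. c i k j"] s23[of c] by simp
  moreover have "F (\<lambda>i j k. c k i j) = F c"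
    using s23[of "\<lambda>i j k. c j i k"] s12[of c] by simp
  moreover have "F (\<lambda>i j k. c k j i) = F c"
    using s12[of "\<lambda>i j k. c k i j"] \<open>F (\<lambda>i j k. c k i j) = F c\<close> by simp
  ultimately have "F (\<lambda>i j k. c i j k + c i k j + c j i k + c j k i + c k i j + c k j i) = 6 * F c"
    using s12[of c] s23[of c] by (simp add: F_def distrib_right sum.distrib)
  then show ?thesis
    by (simp add: F_def)
qed

text \<open>
  The multiplier \<open>u\<close> is chosen so that \<open>f + u Nm\<close> has no terms of degree 0 and 1. The remaining quadratic and cubic
  tensors need not be symmetric; a form determines only its symmetrization, and that is what the vanishing on
  the roots shows to be zero.
\<close>
lemma Nm_dvd_if_degree_le_3:
  assumes deg: "total_degree f \<le> 3" and van: "f \<in> vanishing_ideal (complexify ` E8)"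
  shows "Nm dvd f"
proof -
  obtain c l q t where f: "f = Const c + (\<Sum>i\<in>UNIV. Var i * (Const (l i)
     + (\<Sum>j\<in>UNIV. Var j * (Const (q i j) + (\<Sum>k\<in>UNIV. Var k * Const (t i j k))))))"
    using cubic_decomposition[OF deg] .
  define u where "u = Const (c / 2) + (\<Sum>i\<in>UNIV. Const (l i / 2) * Var i)"
  \<comment> \<open>The constant and linear terms of \<open>f\<close>, multiplied by \<open>|Y|\<^sup>2 / 2\<close>, are absorbed into the tensors.\<close>
  define q' where "q' i j = q i j + (if j = i then c / 2 else 0)" for i j
  define t' where "t' i j k = t i j k + (if k = j then l i / 2 else 0)" for i j k
  define Q where "Q = (\<Sum>i\<in>UNIV. \<Sum>j\<in>UNIV. Const (q' i j) * Var i * Var j)"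
  define T where "T = (\<Sum>i\<in>UNIV. \<Sum>j\<in>UNIV. \<Sum>k\<in>UNIV. Const (t' i j k) * Var i * Var j * Var k)"
  have Q_eq: "Q = (\<Sum>i\<in>UNIV. \<Sum>j\<in>UNIV. Const (q i j) * Var i * Var j) + (\<Sum>i\<in>UNIV. Const (c / 2) * Var i ^ 2)"
  proof -
    have "Const (q' i j) * Var i * Var j =
        Const (q i j) * Var i * Var j + (if j = i then Const (c / 2) * Var i ^ 2 else 0)" for i j
      by (simp add: q'_def Const_add distrib_right power2_eq_square mult.assoc)
    then show ?thesis
      by (simp add: Q_def sum.distrib)
  qed
  have T_eq: "T = (\<Sum>i\<in>UNIV. \<Sum>j\<in>UNIV. \<Sum>k\<in>UNIV. Const (t i j k) * Var i * Var j * Var k)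
      + (\<Sum>i\<in>UNIV. \<Sum>j\<in>UNIV. Const (l i / 2) * Var i * Var j ^ 2)"
  proof -
    have "Const (t' i j k) * Var i * Var j * Var k =
        Const (t i j k) * Var i * Var j * Var k + (if k = j then Const (l i / 2) * Var i * Var j ^ 2 else 0)" for i j k
      by (simp add: t'_def Const_add distrib_right power2_eq_square mult.assoc)
    then show ?thesis
      by (simp add: T_def sum.distrib)
  qed
  have double: "Const 2 * u = Const c + (\<Sum>i\<in>UNIV. Const (l i) * Var i)"
  proof -
    have half: "Const 2 * Const (z / 2) = Const z" for z
      unfolding Const_mult[symmetric] by simp
    show ?thesis
      by (simp add: u_def distrib_left sum_distrib_left mult.assoc[symmetric] half del: Const_numeral)
  qed
  have norm_u: "(\<Sum>j\<in>UNIV. Var j ^ 2) * u = (\<Sum>i\<in>UNIV. Const (c / 2) * Var i ^ 2)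
      + (\<Sum>i\<in>UNIV. \<Sum>j\<in>UNIV. Const (l i / 2) * Var i * Var j ^ 2)"
    by (simp add: u_def distrib_left sum_distrib_left sum_distrib_right mult.commute)
  have "f = Const 2 * u + (\<Sum>i\<in>UNIV. \<Sum>j\<in>UNIV. Const (q i j) * Var i * Var j)
      + (\<Sum>i\<in>UNIV. \<Sum>j\<in>UNIV. \<Sum>k\<in>UNIV. Const (t i j k) * Var i * Var j * Var k)"
    unfolding f double by (simp add: distrib_left sum.distrib sum_distrib_left mult_ac)
  then have split: "f = (Q + T) - Nm * u"
    unfolding Q_eq T_eq Nm_def left_diff_distrib norm_u by simp
  have eval_Q: "eval_poly Q (complexify x) = bil q' x x" for x
    by (simp add: Q_def bil_def complexify_def)
  have eval_T: "eval_poly T (complexify x) = tri t' x x x" for x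
    by (simp add: T_def tri_def complexify_def)
  have sum_zero: "bil q' x x + tri t' x x x = 0" if "x \<in> E8" for x
  proof -
    have "eval_poly f (complexify x) = 0"
      using van that by (simp add: vanishing_ideal_def)
    then show ?thesis
      using E8_norm[OF that] by (simp add: split eval_Q eval_T)
  qed
  have parity: "bil q' (- x) (- x) = bil q' x x" "tri t' (- x) (- x) (- x) = - tri t' x x x" for x
    by (simp_all add: bil_def tri_def sum_negf)
  have bil_zero: "bil q' x x = 0" and tri_zero: "tri t' x x x = 0" if "x \<in> E8" for x
  proof -
    have eqs: "bil q' x x + tri t' x x x = 0" "bil q' x x - tri t' x x x = 0"
      using sum_zero[OF that] sum_zero[OF E8_uminus[OF that]] by (simp_all add: parity)
    have "2 * bil q' x x = (bil q' x x + tri t' x x x) + (bil q' x x - tri t' x x x)"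
      by simp
    then show "bil q' x x = 0"
      unfolding eqs by simp
    then show "tri t' x x x = 0"
      using eqs(1) by simp
  qed
  have "q' i j + q' j i = 0" for i j
  proof (rule quadratic_vanishing_on_E8[of "\<lambda>i j. q' i j + q' j i"])
    show "bil (\<lambda>i j. q' i j + q' j i) x x = 0" if "x \<in> E8" for x
      unfolding bil_def sum_symmetrize2 unfolding bil_def[symmetric] bil_zero[OF that] by simp
  qed simp
  then have "Const 2 * Q = 0"
    unfolding Q_def Const_numeral sum_symmetrize2[symmetric] Const_add[symmetric] by simp
  then have "Q = 0"
    by (metis Const_mult_inverse mult_zero_right zero_neq_numeral)
  have "t' i j k + t' i k j + t' j i k + t' j k i + t' k i j + t' k j i = 0" for i j k
  proof (rule cubic_vanishing_on_E8[of "\<lambda>i j k. t' i j k + t' i k j + t' j i k + t' j k i + t' k i j + t' k j i"])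
    show "tri (\<lambda>i j k. t' i j k + t' i k j + t' j i k + t' j k i + t' k i j + t' k j i) x x x = 0"
      if "x \<in> E8" for x
      unfolding tri_def sum_symmetrize3 unfolding tri_def[symmetric] tri_zero[OF that] by simp
  qed simp_all
  then have "Const 6 * T = 0"
    unfolding T_def Const_numeral sum_symmetrize3[symmetric] Const_add[symmetric] by simp
  then have "T = 0"
    by (metis Const_mult_inverse mult_zero_right zero_neq_numeral)
  have "f = Nm * (- u)"
    using split \<open>Q = 0\<close> \<open>T = 0\<close> by simp
  then show ?thesis ..
qed

section \<open>Degree four\<close>

lemma total_degree_lin_form: "total_degree (lin_form c) \<le> 1"
  unfolding lin_form_def
  by (intro total_degree_sum total_degree_mult[OF total_degree_Const total_degree_Var, of 0]) simp

lemma total_degree_root_quartic: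
  "total_degree (lin_form c * (lin_form a - 1) * lin_form a * (lin_form a + 1)) \<le> 4"
proof -
  have "total_degree (lin_form a - 1) \<le> 1" "total_degree (lin_form a + 1) \<le> 1"
    unfolding Const_1[symmetric] by (intro total_degree_diff total_degree_add total_degree_lin_form total_degree_Const)+
  then have "total_degree (lin_form c * (lin_form a - 1)) \<le> 2"
    by (intro total_degree_mult[OF total_degree_lin_form]) auto
  then have "total_degree (lin_form c * (lin_form a - 1) * lin_form a) \<le> 3"
    by (rule total_degree_mult[OF _ total_degree_lin_form]) simp
  then show ?thesis
    using \<open>total_degree (lin_form a + 1) \<le> 1\<close> by (rule total_degree_mult) simp
qed

lemma total_degree_generators:
  assumes "f \<in> generators R b"
  shows "total_degree f \<le> 4"
  using assms unfolding generators_def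
proof (elim insertE UN_E)
  have "total_degree (Var i ^ 2 :: 8 cpoly) \<le> 4" for i
    unfolding power2_eq_square by (rule total_degree_mult[OF total_degree_Var total_degree_Var]) simp
  then show "total_degree f \<le> 4" if "f = Nm"
    unfolding that Nm_def by (intro total_degree_diff total_degree_sum total_degree_Const)
next
  show "total_degree f \<le> 4" if "f \<in> B_set a (b a)" for a
    using that total_degree_root_quartic by (auto simp: B_set_def)
qed

text \<open>
  The witness is one of the quartics with \<open>a = e\<^sub>0 + e\<^sub>1\<close> and \<open>c = e\<^sub>0 - e\<^sub>1\<close>. It has the value 2 at the point
  \<open>(\<surd>2, 0, \<dots>, 0)\<close>, at which \<open>Nm\<close> vanishes.
\<close>
lemma nontrivial_quartic:
  "\<exists>f\<in>vanishing_ideal (complexify ` E8). nontrivial f \<and> total_degree f \<le> 4"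
proof -
  define a :: "real ^ 8" where "a = axis 0 1 + axis 1 1"
  define c :: "real ^ 8" where "c = axis 0 1 - axis 1 1"
  have ne: "(0 :: 8) \<noteq> 1" by simp
  have a: "a \<in> E8"
    unfolding a_def using ne by (rule root_add)
  have "c \<bullet> a = 0"
    by (simp add: a_def c_def inner_diff_left inner_axis') (simp add: axis_def)
  let ?f = "lin_form c * (lin_form a - 1) * lin_form a * (lin_form a + 1)"
  have "eval_poly ?f (complexify x) = 0" if "x \<in> E8" for x
    using E8_inner_cases[OF a that] \<open>c \<bullet> a = 0\<close> by auto
  then have "?f \<in> vanishing_ideal (complexify ` E8)"
    by (simp add: vanishing_ideal_def)
  moreover have "nontrivial ?f"
  proof -
    define x :: "real ^ 8" where "x = sqrt 2 *\<^sub>R axis 0 1"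
    have "c \<bullet> x = sqrt 2" "a \<bullet> x = sqrt 2" "x \<bullet> x = 2"
      by (simp_all add: a_def c_def x_def inner_diff_left inner_add_left inner_axis') (simp_all add: axis_def)
    then have "eval_poly Nm (complexify x) = 0" and "eval_poly ?f (complexify x) = of_real (sqrt 2 * (sqrt 2 - 1) * sqrt 2 * (sqrt 2 + 1))"
      by simp_all
    moreover have "sqrt 2 * (sqrt 2 - 1) * sqrt 2 * (sqrt 2 + 1) = 2"
      by (simp add: algebra_simps)
    ultimately have "eval_poly Nm (complexify x) = 0" "eval_poly ?f (complexify x) = 2"
      by (simp_all only: of_real_numeral)
    then have "?f \<noteq> Nm * k" for k
      by (metis eval_poly_mult mult_zero_left zero_neq_numeral)
    then show ?thesis
      unfolding nontrivial_def by (blast elim: dvdE)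
  qed
  ultimately show ?thesis
    using total_degree_root_quartic by blast
qed

theorem theorem3p1:
  fixes R :: "(real ^ 8) set"
    and b :: "real ^ 8 \<Rightarrow> nat \<Rightarrow> real ^ 8"
  assumes reps: "antipodal_representatives R"
    and indep: "\<And>a. a \<in> R \<Longrightarrow> inj_on (b a) {1..7} \<and> independent (b a ` {1..7})"
    and orth: "\<And>a i. a \<in> R \<Longrightarrow> i \<in> {1..7} \<Longrightarrow> b a i \<bullet> a = 0"
  defines "G \<equiv> generators R b"
  defines "I \<equiv> ideal_gen G"
  defines "X \<equiv> complexify ` E8"
  shows "zero_locus I = X
    \<and> ((\<forall>p\<in>zero_locus I. simple_zero G p) \<and> radical_ideal I)
    \<and> ((\<exists>f\<in>vanishing_ideal X. nontrivial f \<and> total_degree f = 4)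
        \<and> (\<forall>f\<in>vanishing_ideal X. nontrivial f \<longrightarrow> 4 \<le> total_degree f))
    \<and> (\<exists>S. (\<forall>f\<in>S. total_degree f \<le> 4) \<and> ideal_gen S = vanishing_ideal X)"
proof -
  have root: "(\<Prod>v\<in>root_values. lin_form a - Const v) \<in> ideal_gen G" if "a \<in> E8" for a
    unfolding G_def using reps indep orth that by (rule root_polynomial_in_ideal)
  have "R \<subseteq> E8"
    using reps by (simp add: antipodal_representatives_def)
  have "Nm \<in> G"
    by (simp add: G_def generators_def)
  have locus_G: "zero_locus G = X"
    unfolding X_def
  proof
    show "zero_locus G \<subseteq> complexify ` E8"
      using root \<open>Nm \<in> G\<close> by (rule zero_locus_subset_complexify_E8)
    show "complexify ` E8 \<subseteq> zero_locus G"
      unfolding G_def using \<open>R \<subseteq> E8\<close> orth by (rule complexify_E8_subset_zero_locus)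
  qed
  then have locus_I: "zero_locus I = X"
    by (simp add: I_def zero_locus_ideal_gen)
  have ideal_eq: "vanishing_ideal X = I"
    unfolding I_def locus_G[symmetric]
    by (rule seidenberg) (rule coordinate_polynomial_in_ideal[OF root])
  have simple: "simple_zero G p" if p: "p \<in> X" for p
  proof -
    obtain x where x: "x \<in> E8" "p = complexify x"
      using p unfolding X_def by blast
    have "jacobian_rank G p = 8"
      unfolding x(2) by (rule jacobian_rank_full[OF root x(1)]) (use p x locus_G in simp_all)
    then show ?thesis
      using p locus_I by (simp add: simple_zero_def I_def)
  qed
  have radical: "radical_ideal I"
    unfolding ideal_eq[symmetric] by (rule radical_ideal_vanishing_ideal)
  have lower: "4 \<le> total_degree f" if "f \<in> vanishing_ideal X" "nontrivial f" for f
    using that Nm_dvd_if_degree_le_3[of f] unfolding X_def nontrivial_def by linarith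
  obtain f where "f \<in> vanishing_ideal X" "nontrivial f" "total_degree f \<le> 4"
    using nontrivial_quartic unfolding X_def by blast
  then have "\<exists>f\<in>vanishing_ideal X. nontrivial f \<and> total_degree f = 4"
    using lower by (metis order_antisym)
  moreover have "\<exists>S. (\<forall>f\<in>S. total_degree f \<le> 4) \<and> ideal_gen S = vanishing_ideal X"
    using total_degree_generators ideal_eq unfolding I_def G_def by blast
  ultimately show ?thesis
    using locus_I simple radical lower by blast
qed

end
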